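(* Let $r\ge 2$ be a natural number, let $c_r>0$ be a constant, and let $\mathscr{S}\subset\mathbb{N}$ be a subset such that $\mathscr{S}(x)\sim c_r x^{1/r}$ as $x\to\infty$. Then for any additive complement $\mathscr{W}$ of $\mathscr{S}$ we have $$\sum_{n\le N} f_{\mathscr{S},\mathscr{W}}(n)-N\gg N^{1-\frac1r}$$ for all sufficiently large $N$, where the implied constant depends at most on $r$ and $c_r$, and $$f_{\mathscr{S},\mathscr{W}}(n)=\#\{(s,w)\in\mathscr{S}\times\mathscr{W}: n=s+w\}.$$
   Context: $\mathbb{N}=\{1,2,3,\dots\}$. For a set $A\subset\mathbb{N}$ and real $x$, $A(x)=|A\cap[1,x]|$. A set $\mathscr{W}\subset\mathbb{N}$ is an additive complement of $\mathscr{S}\subset\mathbb{N}$ if all sufficiently large integers can be written as the sum of an element of $\mathscr{W}$ and an element of $\mathscr{S}$. Sums over $n\le N$ run over integers $1\le n\le N$. The notation $F(N)\gg G(N)$ (with $G(N)>0$) for all sufficiently large $N$ means there are a constant $C>0$ (the implied constant) and an $N_0$ with $F(N)\ge C\,G(N)$ for all integers $N\ge N_0$; here $C$ depends only on $r$ and $c_r$, while $N_0$ may depend on $\mathscr{S}$ and $\mathscr{W}$. *)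

theory Defs
  imports Complex_Main "HOL-Library.Landau_Symbols"
begin

text \<open>
  Sets of positive integers are sets \<open>A :: nat set\<close> with \<open>A \<subseteq> {1..}\<close>.
\<close>

definition counting :: "nat set \<Rightarrow> real \<Rightarrow> nat" where
  "counting A x = card {a \<in> A. 1 \<le> a \<and> real a \<le> x}"

definition additive_complement :: "nat set \<Rightarrow> nat set \<Rightarrow> bool" where
  "additive_complement W S \<longleftrightarrow>
     W \<subseteq> {1..} \<and> (\<forall>\<^sub>F n in sequentially. \<exists>w\<in>W. \<exists>s\<in>S. n = w + s)"

definition rep_count :: "nat set \<Rightarrow> nat set \<Rightarrow> nat \<Rightarrow> nat" where
  "rep_count S W n = card {(s, w) \<in> S \<times> W. n = s + w}"

end

theory Submission
  imports Defs "HOL-Analysis.Convex"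
begin

text \<open>
  Suppose the excess up to \<open>N\<close> is at most \<open>\<epsilon> N^(1 - 1/r)\<close>. As \<open>f \<le> S(N) = O(N^(1/r))\<close>, the sum of \<open>(f(n) - 1)\<^sup>2\<close> is then
  at most \<open>\<delta> N\<close>, so \<open>f\<close> is close to the constant \<open>1\<close> in mean square. Cut off \<open>S\<close> and \<open>W\<close> at a
  height \<open>h\<close> that is a small multiple of \<open>N\<close>, giving \<open>S\<^sub>h\<close> and \<open>W\<^sub>h\<close>, and compare \<open>u = S * W\<^sub>h\<close> with
  \<open>v = S\<^sub>h * W\<close>, where \<open>S\<close> and \<open>W\<close> carry the weight \<open>\<rho>\<^sup>n\<close>. The transforms satisfy
  \<open>\<bar>u v\<bar> = \<bar>S * W\<bar> \<bar>S\<^sub>h * W\<^sub>h\<bar>\<close>, and the weighted \<open>S * W\<close> is nearly invariant under shifts by \<open>d \<ll> h\<close>.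
  Hence the correlation of \<open>u\<close> and \<open>v\<close> at lag \<open>d\<close> is bounded by twice the correlation at lag \<open>0\<close>
  plus \<open>h\<close>. At lag \<open>0\<close> it is \<open>O(h)\<close>, because a sum represented by both \<open>u\<close> and \<open>v\<close> must be at most
  \<open>2 h\<close> if its representation is unique. Averaged over the lags, however, the regularity of \<open>S\<close> forces
  a contribution \<open>\<gg> h\<close> from every dyadic scale between \<open>h\<close> and \<open>N\<close>, hence \<open>\<gg> h log (N / h)\<close>.
\<close>

section \<open>The four-function inequality\<close>

text \<open>The autocorrelation of a unit mass at 0 minus a unit mass at \<open>d\<close>, so that a
  form with this kernel is an inner product of differences at lag \<open>d\<close>.\<close>

definition lag_kernel :: "nat \<Rightarrow> nat \<Rightarrow> nat \<Rightarrow> real" where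
  "lag_kernel d x y = 2 * of_bool (x = y) - of_bool (x = y + d) - of_bool (x + d = y)"

lemma indicator_difference_inner:
  fixes Z :: "int set"
  assumes "finite Z" "x \<in> Z" "y \<in> Z" "x + int d \<in> Z" "y + int d \<in> Z"
  shows "(\<Sum>z\<in>Z. (of_bool (x = z) - of_bool (x + int d = z)) * (of_bool (y = z) - of_bool (y + int d = z)))
     = (2 * of_bool (x = y) - of_bool (x = y + int d) - of_bool (x + int d = y) :: real)"
proof -
  have *: "(\<Sum>z\<in>Z. of_bool (a = z) * of_bool (b = z)) = (of_bool (a = b) :: real)" if "a \<in> Z" for a b
  proof -
    have "(\<Sum>z\<in>Z. of_bool (a = z) * of_bool (b = z)) = (\<Sum>z\<in>Z. if a = z then of_bool (b = a) else (0::real))"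
      by (intro sum.cong) auto
    also have "\<dots> = of_bool (a = b)" using that assms(1) by (simp add: eq_commute)
    finally show ?thesis .
  qed
  have "(\<Sum>z\<in>Z. (of_bool (x = z) - of_bool (x + int d = z)) * (of_bool (y = z) - of_bool (y + int d = z)))
    = (\<Sum>z\<in>Z. of_bool (x = z) * of_bool (y = z)) - (\<Sum>z\<in>Z. of_bool (x = z) * of_bool (y + int d = z))
     - (\<Sum>z\<in>Z. of_bool (x + int d = z) * of_bool (y = z)) + ((\<Sum>z\<in>Z. of_bool (x + int d = z) * of_bool (y + int d = z)) :: real)"
    unfolding sum_subtractf [symmetric] sum.distrib [symmetric]
    by (intro sum.cong refl) (simp add: algebra_simps del: of_bool_eq)
  also have "\<dots> = 2 * of_bool (x = y) - of_bool (x = y + int d) - of_bool (x + int d = y)"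
    using assms by (simp add: *)
  finally show ?thesis .
qed

text \<open>The inner product of the lag-\<open>d\<close> differences of two convolutions, kept as a
  fourfold sum so that its variables can be regrouped.\<close>

definition lag_form :: "nat \<Rightarrow> nat \<Rightarrow> (nat \<Rightarrow> real) \<Rightarrow> (nat \<Rightarrow> real) \<Rightarrow> (nat \<Rightarrow> real) \<Rightarrow> (nat \<Rightarrow> real) \<Rightarrow> real" where
  "lag_form N d a b a' b' = (\<Sum>s\<le>N. \<Sum>w\<le>N. \<Sum>s'\<le>N. \<Sum>w'\<le>N. a s * b w * a' s' * b' w' * lag_kernel d (s + w) (s' + w'))"

lemma sum4_product:
  fixes a b a' b' :: "nat \<Rightarrow> real" and e e' :: "nat \<Rightarrow> nat \<Rightarrow> 'z \<Rightarrow> real"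
  shows "(\<Sum>z\<in>Z. (\<Sum>s\<le>N. \<Sum>w\<le>N. a s * b w * e s w z) * (\<Sum>s\<le>N. \<Sum>w\<le>N. a' s * b' w * e' s w z))
   = (\<Sum>s\<le>N. \<Sum>w\<le>N. \<Sum>s'\<le>N. \<Sum>w'\<le>N. a s * b w * a' s' * b' w' * (\<Sum>z\<in>Z. e s w z * e' s' w' z))"
proof -
  have "(\<Sum>z\<in>Z. (\<Sum>s\<le>N. \<Sum>w\<le>N. a s * b w * e s w z) * (\<Sum>s\<le>N. \<Sum>w\<le>N. a' s * b' w * e' s w z))
     = (\<Sum>z\<in>Z. \<Sum>s\<le>N. \<Sum>w\<le>N. \<Sum>s'\<le>N. \<Sum>w'\<le>N. (a s * b w * e s w z) * (a' s' * b' w' * e' s' w' z))"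
    (is "_ = (\<Sum>z\<in>Z. ?g z)")
  proof (rule sum.cong [OF refl])
    fix z
    show "(\<Sum>s\<le>N. \<Sum>w\<le>N. a s * b w * e s w z) * (\<Sum>s\<le>N. \<Sum>w\<le>N. a' s * b' w * e' s w z) = ?g z"
      by (subst sum_distrib_right, rule sum.cong [OF refl],
          subst sum_distrib_right, rule sum.cong [OF refl],
          subst sum_distrib_left, rule sum.cong [OF refl], rule sum_distrib_left)
  qed
  also have "\<dots> = (\<Sum>s\<le>N. \<Sum>z\<in>Z. \<Sum>w\<le>N. \<Sum>s'\<le>N. \<Sum>w'\<le>N. (a s * b w * e s w z) * (a' s' * b' w' * e' s' w' z))"
    by (rule sum.swap)
  also have "\<dots> = (\<Sum>s\<le>N. \<Sum>w\<le>N. \<Sum>z\<in>Z. \<Sum>s'\<le>N. \<Sum>w'\<le>N. (a s * b w * e s w z) * (a' s' * b' w' * e' s' w' z))"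
    by (intro sum.cong refl) (rule sum.swap)
  also have "\<dots> = (\<Sum>s\<le>N. \<Sum>w\<le>N. \<Sum>s'\<le>N. \<Sum>z\<in>Z. \<Sum>w'\<le>N. (a s * b w * e s w z) * (a' s' * b' w' * e' s' w' z))"
    by (intro sum.cong refl) (rule sum.swap)
  also have "\<dots> = (\<Sum>s\<le>N. \<Sum>w\<le>N. \<Sum>s'\<le>N. \<Sum>w'\<le>N. \<Sum>z\<in>Z. (a s * b w * e s w z) * (a' s' * b' w' * e' s' w' z))"
    by (intro sum.cong refl) (rule sum.swap)
  also have "\<dots> = (\<Sum>s\<le>N. \<Sum>w\<le>N. \<Sum>s'\<le>N. \<Sum>w'\<le>N. a s * b w * a' s' * b' w' * (\<Sum>z\<in>Z. e s w z * e' s' w' z))"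
    by (intro sum.cong refl) (simp add: sum_distrib_left mult_ac)
  finally show ?thesis .
qed

lemma swap_inner:
  fixes g :: "nat \<Rightarrow> nat \<Rightarrow> nat \<Rightarrow> nat \<Rightarrow> real"
  shows "(\<Sum>s\<le>N. \<Sum>w\<le>N. \<Sum>s'\<le>N. \<Sum>w'\<le>N. g s w s' w') = (\<Sum>s\<le>N. \<Sum>w\<le>N. \<Sum>s'\<le>N. \<Sum>w'\<le>N. g s w' s' w)"
proof (rule sum.cong [OF refl])
  fix s
  have "(\<Sum>w\<le>N. \<Sum>s'\<le>N. \<Sum>w'\<le>N. g s w s' w') = (\<Sum>s'\<le>N. \<Sum>w\<le>N. \<Sum>w'\<le>N. g s w s' w')"
    by (rule sum.swap)
  also have "\<dots> = (\<Sum>s'\<le>N. \<Sum>w'\<le>N. \<Sum>w\<le>N. g s w s' w')"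
    by (rule sum.cong [OF refl], rule sum.swap)
  also have "\<dots> = (\<Sum>w'\<le>N. \<Sum>s'\<le>N. \<Sum>w\<le>N. g s w s' w')"
    by (rule sum.swap)
  finally show "(\<Sum>w\<le>N. \<Sum>s'\<le>N. \<Sum>w'\<le>N. g s w s' w') = (\<Sum>w\<le>N. \<Sum>s'\<le>N. \<Sum>w'\<le>N. g s w' s' w)" .
qed

text \<open>The equation \<open>s + w' = s' + w\<close> also reads \<open>s - w = s' - w'\<close>,
  so exchanging \<open>w\<close> and \<open>w'\<close> turns sums into differences. The integer
  range of \<open>z\<close> contains every difference and its shift by \<open>d\<close>.\<close>

lemma lag_form_difference_form:
  "lag_form N d a b' a' b =
    (\<Sum>z\<in>{- int N..int N + int d}.
       (\<Sum>s\<le>N. \<Sum>w\<le>N. a s * b w * (of_bool (int s - int w = z) - of_bool (int s - int w + int d = z))) *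
       (\<Sum>s\<le>N. \<Sum>w\<le>N. a' s * b' w * (of_bool (int s - int w = z) - of_bool (int s - int w + int d = z))))"
  (is "_ = ?R")
proof -
  have "?R = (\<Sum>s\<le>N. \<Sum>w\<le>N. \<Sum>s'\<le>N. \<Sum>w'\<le>N. a s * b w * a' s' * b' w' * lag_kernel d (s + w') (s' + w))"
    unfolding sum4_product
  proof (intro sum.cong refl arg_cong2 [where f="(*)"])
    fix s w s' w' assume "s \<in> {..N}" "w \<in> {..N}" "s' \<in> {..N}" "w' \<in> {..N}"
    then have "(\<Sum>z\<in>{- int N..int N + int d}. (of_bool (int s - int w = z) - of_bool (int s - int w + int d = z)) *
         (of_bool (int s' - int w' = z) - of_bool (int s' - int w' + int d = z)))
      = (2 * of_bool (int s - int w = int s' - int w') - of_bool (int s - int w = int s' - int w' + int d)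
          - of_bool (int s - int w + int d = int s' - int w') :: real)"
      by (intro indicator_difference_inner) auto
    also have "\<dots> = lag_kernel d (s + w') (s' + w)"
      unfolding lag_kernel_def by (intro arg_cong2 [where f="(-)"] arg_cong2 [where f="(*)"] refl arg_cong [where f=of_bool]) linarith+
    finally show "(\<Sum>z\<in>{- int N..int N + int d}. (of_bool (int s - int w = z) - of_bool (int s - int w + int d = z)) *
         (of_bool (int s' - int w' = z) - of_bool (int s' - int w' + int d = z))) = lag_kernel d (s + w') (s' + w)" .
  qed
  also have "\<dots> = lag_form N d a b' a' b"
    unfolding lag_form_def by (subst swap_inner) (simp add: mult_ac)
  finally show ?thesis ..
qed

text \<open>
  The form depends on its arguments only through \<open>s + w - s' - w'\<close>, so it may also be read as a form in
  the differences \<open>s - w'\<close>; this is the real-space version of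
  \<open>\<bar>a\<^sub>1 b\<^sub>2\<bar> \<bar>a\<^sub>2 b\<^sub>1\<bar> = \<bar>a\<^sub>1 b\<^sub>1\<bar> \<bar>a\<^sub>2 b\<^sub>2\<bar>\<close> for the Fourier transforms.
\<close>

lemma four_function:
  "(lag_form N d a1 b2 a2 b1)\<^sup>2 \<le> lag_form N d a1 b1 a1 b1 * lag_form N d a2 b2 a2 b2"
  unfolding lag_form_difference_form [of N d a1 b2 a2 b1] lag_form_difference_form [of N d a1 b1 a1 b1]
    lag_form_difference_form [of N d a2 b2 a2 b2] power2_eq_square [symmetric]
  by (rule Cauchy_Schwarz_ineq_sum)

section \<open>Convolutions, shifts and correlations at a lag\<close>

definition conv :: "nat \<Rightarrow> (nat \<Rightarrow> real) \<Rightarrow> (nat \<Rightarrow> real) \<Rightarrow> nat \<Rightarrow> real" where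
  "conv N a b z = (\<Sum>s\<le>N. \<Sum>w\<le>N. a s * b w * of_bool (s + w = z))"

text \<open>The default 0 treats \<open>F\<close> as extended by zero to negative arguments.\<close>

definition shift_by :: "nat \<Rightarrow> (nat \<Rightarrow> real) \<Rightarrow> nat \<Rightarrow> real" where
  "shift_by d F z = (if d \<le> z then F (z - d) else 0)"

lemma shift_conv: "shift_by d (conv N a b) z = (\<Sum>s\<le>N. \<Sum>w\<le>N. a s * b w * of_bool (s + w + d = z))"
proof (cases "d \<le> z")
  case True
  then show ?thesis unfolding shift_by_def conv_def
    by (auto intro!: sum.cong)
next
  case False
  then show ?thesis unfolding shift_by_def by simp
qed

text \<open>With equal pairs the form is a squared norm. This makes it nonnegative and opens it to
  mean-square estimates.\<close>

lemma lag_form_sum_form: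
  "lag_form N d a b a b = (\<Sum>z\<le>2*N+d. (conv N a b z - shift_by d (conv N a b) z)\<^sup>2)"
proof -
  have "(\<Sum>z\<le>2*N+d. (conv N a b z - shift_by d (conv N a b) z)\<^sup>2) =
    (\<Sum>z\<le>2*N+d. (\<Sum>s\<le>N. \<Sum>w\<le>N. a s * b w * (of_bool (s + w = z) - of_bool (s + w + d = z))) *
       (\<Sum>s\<le>N. \<Sum>w\<le>N. a s * b w * (of_bool (s + w = z) - of_bool (s + w + d = z))))"
    unfolding shift_conv unfolding conv_def
    by (simp only: power2_eq_square right_diff_distrib sum_subtractf)
  also have "\<dots> = lag_form N d a b a b"
    unfolding sum4_product lag_form_def
  proof (intro sum.cong refl arg_cong2 [where f="(*)"])
    fix s w s' w' assume a: "s \<in> {..N}" "w \<in> {..N}" "s' \<in> {..N}" "w' \<in> {..N}"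
    have "(\<Sum>z\<le>2*N+d. (of_bool (s + w = z) - of_bool (s + w + d = z)) *
         (of_bool (s' + w' = z) - of_bool (s' + w' + d = z)))
      = (\<Sum>z\<in>int ` {..2*N+d}. (of_bool (int (s + w) = z) - of_bool (int (s + w) + int d = z)) *
         (of_bool (int (s' + w') = z) - of_bool (int (s' + w') + int d = z)) :: real)"
      by (subst sum.reindex) (auto intro!: sum.cong simp flip: of_nat_add)
    also have "\<dots> = 2 * of_bool (int (s + w) = int (s' + w')) - of_bool (int (s + w) = int (s' + w') + int d)
        - of_bool (int (s + w) + int d = int (s' + w'))"
      using a by (intro indicator_difference_inner) (auto simp flip: of_nat_add)
    also have "\<dots> = lag_kernel d (s + w) (s' + w')"
      unfolding lag_kernel_def by (simp flip: of_nat_add)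
    finally show "(\<Sum>z\<le>2*N+d. (of_bool (s + w = z) - of_bool (s + w + d = z)) *
         (of_bool (s' + w' = z) - of_bool (s' + w' + d = z))) = lag_kernel d (s + w) (s' + w')" .
  qed
  finally show ?thesis ..
qed

text \<open>One-sided, so that summing over \<open>d\<close> from 1 to \<open>L\<close> collects the
  sums in a window just below \<open>s' + w'\<close>.\<close>

definition lag_corr :: "nat \<Rightarrow> nat \<Rightarrow> (nat \<Rightarrow> real) \<Rightarrow> (nat \<Rightarrow> real) \<Rightarrow> (nat \<Rightarrow> real) \<Rightarrow> (nat \<Rightarrow> real) \<Rightarrow> real" where
  "lag_corr N d a b a' b' = (\<Sum>s\<le>N. \<Sum>w\<le>N. \<Sum>s'\<le>N. \<Sum>w'\<le>N. a s * b w * a' s' * b' w' * of_bool (s + w + d = s' + w'))"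

lemma lag_corr_0: "lag_corr N 0 a b a' b' = (\<Sum>z\<le>2*N. conv N a b z * conv N a' b' z)"
  unfolding lag_corr_def conv_def sum4_product
proof (intro sum.cong refl arg_cong2 [where f="(*)"])
  fix s w s' w' assume "s \<in> {..N}" "w \<in> {..N}" "s' \<in> {..N}" "w' \<in> {..N}"
  then have "(\<Sum>z\<le>2*N. of_bool (s + w = z) * of_bool (s' + w' = z))
     = (\<Sum>z\<le>2*N. if s + w = z then of_bool (s' + w' = s + w) else (0::real))"
    by (intro sum.cong) auto
  also have "\<dots> = of_bool (s + w + 0 = s' + w')"
    using \<open>s \<in> {..N}\<close> \<open>w \<in> {..N}\<close> by auto
  finally show "of_bool (s + w + 0 = s' + w') = (\<Sum>z\<le>2*N. of_bool (s + w = z) * of_bool (s' + w' = z) :: real)" ..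
qed

text \<open>The weights are nonnegative, so one of the two shifted terms of
  \<open>lag_kernel\<close> may be dropped.\<close>

lemma lag_corr_le:
  assumes "\<And>x. a x \<ge> 0" "\<And>x. b x \<ge> 0" "\<And>x. a' x \<ge> 0" "\<And>x. b' x \<ge> 0"
  shows "lag_corr N d a b a' b' \<le> 2 * lag_corr N 0 a b a' b' - lag_form N d a b a' b'"
proof -
  have "lag_form N d a b a' b' + lag_corr N d a b a' b' \<le> 2 * lag_corr N 0 a b a' b'"
    unfolding lag_form_def lag_corr_def sum_distrib_left sum.distrib [symmetric]
  proof (intro sum_mono)
    fix s w s' w'
    have "0 \<le> a s * b w * a' s' * b' w'" using assms by simp
    then show "a s * b w * a' s' * b' w' * lag_kernel d (s + w) (s' + w') +
       a s * b w * a' s' * b' w' * of_bool (s + w + d = s' + w')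
       \<le> 2 * (a s * b w * a' s' * b' w' * of_bool (s + w + 0 = s' + w'))"
      unfolding lag_kernel_def by (auto simp: algebra_simps)
  qed
  then show ?thesis by simp
qed

text \<open>In the application \<open>Y1\<close> is a small multiple and \<open>Y2\<close> a bounded
  multiple of the cutoff height \<open>h\<close>, so that \<open>y\<close> can be taken as
  \<open>h\<close>.\<close>

lemma lag_corr_le_sqrt:
  assumes "\<And>x. a1 x \<ge> 0" "\<And>x. b1 x \<ge> 0" "\<And>x. a2 x \<ge> 0" "\<And>x. b2 x \<ge> 0"
    and "lag_form N d a1 b1 a1 b1 \<le> Y1" "lag_form N d a2 b2 a2 b2 \<le> Y2" "Y1 * Y2 \<le> y\<^sup>2" "0 \<le> y"
  shows "lag_corr N d a1 b2 a2 b1 \<le> 2 * (\<Sum>z\<le>2*N. conv N a1 b2 z * conv N a2 b1 z) + y"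
proof -
  have "(lag_form N d a1 b2 a2 b1)\<^sup>2 \<le> lag_form N d a1 b1 a1 b1 * lag_form N d a2 b2 a2 b2"
    by (rule four_function)
  also have "\<dots> \<le> Y1 * Y2"
    using assms(5,6) by (intro mult_mono) (auto simp: lag_form_sum_form intro!: sum_nonneg order_trans [OF _ assms(5)])
  also have "\<dots> \<le> y\<^sup>2" by fact
  finally have "\<bar>lag_form N d a1 b2 a2 b1\<bar> \<le> y"
    using assms(8) by (metis abs_of_nonneg abs_le_square_iff)
  then show ?thesis using lag_corr_le [of a1 b2 a2 b1 N d] assms lag_corr_0 [of N a1 b2 a2 b1] by simp
qed

section \<open>Bounds at small lags\<close>

lemma sum_shift_le:
  assumes "\<And>z. F z \<ge> 0"
  shows "(\<Sum>z\<le>m. shift_by d F z) \<le> (\<Sum>z\<le>m. F z)"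
proof -
  have "(\<Sum>z\<le>m. shift_by d F z) = (\<Sum>z\<in>{z. d \<le> z \<and> z \<le> m}. F (z - d))"
    unfolding shift_by_def by (subst sum.inter_filter [symmetric]) (auto intro!: sum.cong)
  also have "\<dots> = (\<Sum>z\<in>(\<lambda>z. z - d) ` {z. d \<le> z \<and> z \<le> m}. F z)"
    by (subst sum.reindex) (auto simp: inj_on_def)
  also have "\<dots> \<le> (\<Sum>z\<le>m. F z)"
    using assms by (intro sum_mono2) auto
  finally show ?thesis .
qed

lemma square_diff_le: "(x - y)\<^sup>2 \<le> 2 * x\<^sup>2 + 2 * y\<^sup>2" for x y :: real
  using zero_le_power2 [of "x + y"] by (simp add: power2_eq_square algebra_simps)

lemma sum_square_diff_shift_le:
  "(\<Sum>z\<le>m. (F z - shift_by d F z)\<^sup>2) \<le> 4 * (\<Sum>z\<le>m. (F z)\<^sup>2)"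
proof -
  have "(\<Sum>z\<le>m. (F z - shift_by d F z)\<^sup>2) \<le> (\<Sum>z\<le>m. 2 * (F z)\<^sup>2 + 2 * (shift_by d F z)\<^sup>2)"
    by (intro sum_mono square_diff_le)
  also have "\<dots> = 2 * (\<Sum>z\<le>m. (F z)\<^sup>2) + 2 * (\<Sum>z\<le>m. (shift_by d F z)\<^sup>2)"
    by (simp add: sum.distrib sum_distrib_left)
  also have "(\<Sum>z\<le>m. (shift_by d F z)\<^sup>2) = (\<Sum>z\<le>m. shift_by d (\<lambda>z. (F z)\<^sup>2) z)"
    by (intro sum.cong) (auto simp: shift_by_def)
  also have "\<dots> \<le> (\<Sum>z\<le>m. (F z)\<^sup>2)"
    by (rule sum_shift_le) simp
  finally show ?thesis by simp
qed

text \<open>From \<open>d\<close> on the differences lie in [0, 1], so each square is at most the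
  difference itself, and the shifted total does not exceed the unshifted one. Only the first
  \<open>d\<close> terms, where the shift is 0, cost anything.\<close>

lemma sum_square_diff_shift_power_le:
  assumes "0 \<le> \<rho>" "\<rho> \<le> 1"
  shows "(\<Sum>z\<le>m. (\<rho> ^ z - shift_by d (\<lambda>z. \<rho> ^ z) z)\<^sup>2) \<le> 2 * real d"
proof -
  have "(\<Sum>z\<le>m. (\<rho> ^ z - shift_by d (\<lambda>z. \<rho> ^ z) z)\<^sup>2)
      \<le> (\<Sum>z\<le>m. (shift_by d (\<lambda>z. \<rho> ^ z) z - \<rho> ^ z) + 2 * of_bool (z < d))"
  proof (intro sum_mono)
    fix z
    show "(\<rho> ^ z - shift_by d (\<lambda>z. \<rho> ^ z) z)\<^sup>2 \<le> (shift_by d (\<lambda>z. \<rho> ^ z) z - \<rho> ^ z) + 2 * of_bool (z < d)"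
    proof (cases "d \<le> z")
      case True
      then have "\<rho> ^ z \<le> \<rho> ^ (z - d)" "0 \<le> \<rho> ^ z" "\<rho> ^ (z - d) \<le> 1"
        using assms by (auto intro: power_decreasing power_le_one)
      then have "(\<rho> ^ (z - d) - \<rho> ^ z) * (\<rho> ^ (z - d) - \<rho> ^ z) \<le> (\<rho> ^ (z - d) - \<rho> ^ z) * 1"
        by (intro mult_left_mono) auto
      then show ?thesis using True by (simp add: shift_by_def power2_eq_square algebra_simps)
    next
      case False
      have "\<rho> ^ z \<le> 1" "0 \<le> \<rho> ^ z" using assms by (auto intro: power_le_one)
      then have "(\<rho> ^ z)\<^sup>2 \<le> 1" by (simp add: power_le_one)
      with False \<open>\<rho> ^ z \<le> 1\<close> show ?thesis by (simp add: shift_by_def)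
    qed
  qed
  also have "\<dots> = (\<Sum>z\<le>m. shift_by d (\<lambda>z. \<rho> ^ z) z) - (\<Sum>z\<le>m. \<rho> ^ z) + 2 * (\<Sum>z\<le>m. of_bool (z < d))"
    by (simp add: sum.distrib sum_subtractf sum_distrib_left)
  also have "(\<Sum>z\<le>m. of_bool (z < d)) = real (card {z. z \<le> m \<and> z < d})"
    by (simp add: of_bool_def sum.If_cases Int_def)
  also have "card {z. z \<le> m \<and> z < d} \<le> card {..<d}"
    by (intro card_mono) auto
  finally show ?thesis
    using sum_shift_le [of "\<lambda>z. \<rho> ^ z" d m] assms by simp
qed

section \<open>Convolutions of indicator functions with and without weights\<close>

abbreviation indic :: "nat set \<Rightarrow> nat \<Rightarrow> real" where
  "indic A x \<equiv> of_bool (x \<in> A)"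

lemma finite_reps: "finite {(s, w) \<in> S \<times> W. n = s + (w::nat)}"
  by (rule finite_subset [of _ "{..n} \<times> {..n}"]) auto

lemma conv_ind: "conv N (indic S) (indic W) z = real (card {(s, w) \<in> S \<times> W. z = s + w \<and> s \<le> N \<and> w \<le> N})"
proof -
  have "conv N (indic S) (indic W) z = (\<Sum>(s, w)\<in>{..N} \<times> {..N}. of_bool (s \<in> S \<and> w \<in> W \<and> z = s + w))"
    unfolding conv_def sum.cartesian_product by (intro sum.cong) auto
  also have "\<dots> = real (card (({..N} \<times> {..N}) \<inter> {x. case x of (s, w) \<Rightarrow> s \<in> S \<and> w \<in> W \<and> z = s + w}))"
    by (simp add: of_bool_def case_prod_unfold sum.If_cases)
  also have "({..N} \<times> {..N}) \<inter> {x. case x of (s, w) \<Rightarrow> s \<in> S \<and> w \<in> W \<and> z = s + w}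
     = {(s, w) \<in> S \<times> W. z = s + w \<and> s \<le> N \<and> w \<le> N}"
    by auto
  finally show ?thesis .
qed

lemma conv_ind_eq_0:
  assumes "\<And>s w. \<lbrakk>s \<in> S; w \<in> W; s \<le> N; w \<le> N\<rbrakk> \<Longrightarrow> s + w \<noteq> z"
  shows "conv N (indic S) (indic W) z = 0"
  unfolding conv_def using assms by (intro sum.neutral ballI) auto

lemma rep_count_0: "S \<subseteq> {1..} \<Longrightarrow> rep_count S W 0 = 0"
  unfolding rep_count_def by (auto simp: card_eq_0_iff)

lemma conv_nonneg: "(\<And>x. a x \<ge> 0) \<Longrightarrow> (\<And>x. b x \<ge> 0) \<Longrightarrow> 0 \<le> conv N a b z"
  unfolding conv_def by (intro sum_nonneg) simp

lemma conv_ind_le_rep_count: "conv N (indic S) (indic W) z \<le> rep_count S W z"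
  unfolding conv_ind rep_count_def
  using finite_reps by (intro of_nat_mono card_mono) auto

lemma conv_ind_eq_rep_count:
  assumes "z \<le> N" shows "conv N (indic S) (indic W) z = rep_count S W z"
  unfolding conv_ind rep_count_def
  using assms by (intro arg_cong [where f="\<lambda>A. real (card A)"]) auto

lemma conv_mono:
  assumes "\<And>x. 0 \<le> a x" "\<And>x. 0 \<le> b x" "\<And>x. a x \<le> a' x" "\<And>x. b x \<le> b' x"
  shows "conv N a b z \<le> conv N a' b' z"
  unfolding conv_def using assms
  by (intro sum_mono mult_right_mono mult_mono) (auto intro: order_trans)

text \<open>The weighted convolution is compared with \<open>\<rho> ^ z\<close>, which is nearly
  invariant under shifts. The error \<open>\<rho> ^ z * (g z - 1)\<close> is controlled in mean
  square by \<open>\<Delta>\<close> and, beyond \<open>N\<close>, also by the decay of the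
  weight.\<close>

lemma lag_form_weighted_le:
  fixes S W :: "nat set" and N :: nat
  assumes S: "S \<subseteq> {1..}" and rho: "0 \<le> \<rho>" "\<rho> \<le> 1"
  defines "\<Delta> \<equiv> (\<Sum>n=1..2*N. (real (rep_count S W n) - 1)\<^sup>2)"
  shows "lag_form N d (\<lambda>x. indic S x * \<rho> ^ x) (\<lambda>x. indic W x * \<rho> ^ x) (\<lambda>x. indic S x * \<rho> ^ x) (\<lambda>x. indic W x * \<rho> ^ x)
     \<le> 4 * real d + 8 * (1 + \<Delta> + real (N + d) * \<rho> ^ (2 * N))"
proof -
  define f where "f = conv N (\<lambda>x. indic S x * \<rho> ^ x) (\<lambda>x. indic W x * \<rho> ^ x)"
  define g where "g = conv N (indic S) (indic W)"
  define p where "p = (\<lambda>z::nat. \<rho> ^ z)"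
  define e where "e = (\<lambda>z. f z - p z)"
  have f: "f z = \<rho> ^ z * g z" for z
    unfolding f_def g_def conv_def sum_distrib_left
    by (intro sum.cong) (auto simp: power_add)
  \<comment> \<open>The three terms stand for the missing representation of 0, the deviation of
    \<open>rep_count\<close> from 1, and the sums beyond \<open>N\<close>, where the cutoff can lose
    representations.\<close>
  have e2: "(e z)\<^sup>2 \<le> of_bool (z = 0) + (if z \<in> {1..2*N} then (real (rep_count S W z) - 1)\<^sup>2 else 0)
      + of_bool (N < z) * \<rho> ^ (2 * N)" for z
  proof -
    have p: "0 \<le> p z" "p z \<le> 1" "(p z)\<^sup>2 \<le> 1" unfolding p_def using rho by (auto intro: power_le_one simp: power_le_one)
    have e: "e z = p z * (g z - 1)" unfolding e_def f p_def by (simp add: algebra_simps)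
    consider "z = 0" | "1 \<le> z" "z \<le> N" | "N < z" "z \<le> 2 * N" | "2 * N < z" by linarith
    then show ?thesis
    proof cases
      case 1
      then have "g z = 0" unfolding g_def using S by (intro conv_ind_eq_0) auto
      with e 1 show ?thesis using rho by (simp add: p_def)
    next
      case 2
      then have "g z = rep_count S W z" unfolding g_def by (simp add: conv_ind_eq_rep_count)
      then have "(e z)\<^sup>2 = (p z)\<^sup>2 * (real (rep_count S W z) - 1)\<^sup>2"
        by (simp add: e power_mult_distrib)
      also have "\<dots> \<le> 1 * (real (rep_count S W z) - 1)\<^sup>2" using p by (intro mult_right_mono) auto
      finally show ?thesis using 2 by simp
    next
      \<comment> \<open>Here \<open>g z\<close> may be smaller than \<open>rep_count S W z\<close>.
        If \<open>g z \<le> 1\<close>, the weight alone suffices; otherwise the loss only brings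
        \<open>g z\<close> closer to 1.\<close>
      case 3
      have pz: "(p z)\<^sup>2 \<le> \<rho> ^ (2 * N)"
        unfolding p_def power_mult [symmetric] using rho 3 by (intro power_decreasing) auto
      have "0 \<le> g z" unfolding g_def by (rule conv_nonneg) auto
      have "(e z)\<^sup>2 = (p z)\<^sup>2 * (g z - 1)\<^sup>2" by (simp add: e power_mult_distrib)
      also have "\<dots> \<le> (real (rep_count S W z) - 1)\<^sup>2 + \<rho> ^ (2 * N)"
      proof (cases "g z \<le> 1")
        case True
        with \<open>0 \<le> g z\<close> have "(g z - 1)\<^sup>2 \<le> 1" by (simp add: abs_square_le_1 abs_le_iff)
        then have "(p z)\<^sup>2 * (g z - 1)\<^sup>2 \<le> (p z)\<^sup>2 * 1" by (intro mult_left_mono) auto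
        then have "(p z)\<^sup>2 * (g z - 1)\<^sup>2 \<le> \<rho> ^ (2 * N)" using pz by linarith
        then show ?thesis by (simp add: add_increasing)
      next
        case False
        then have "(g z - 1)\<^sup>2 \<le> (real (rep_count S W z) - 1)\<^sup>2"
          using conv_ind_le_rep_count [of N S W z] unfolding g_def by (intro power_mono) auto
        moreover have "(p z)\<^sup>2 * (g z - 1)\<^sup>2 \<le> 1 * (g z - 1)\<^sup>2" using p by (intro mult_right_mono) auto
        moreover have "0 \<le> \<rho> ^ (2 * N)" using rho by simp
        ultimately show ?thesis by linarith
      qed
      finally show ?thesis using 3 by simp
    next
      case 4
      then have "g z = 0" unfolding g_def by (intro conv_ind_eq_0) auto
      then have "(e z)\<^sup>2 = (p z)\<^sup>2" by (simp add: e)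
      also have "\<dots> \<le> \<rho> ^ (2 * N)"
        unfolding p_def power_mult [symmetric] using rho 4 by (intro power_decreasing) auto
      finally show ?thesis using 4 by simp
    qed
  qed
  have "(\<Sum>z\<le>2*N+d. (e z)\<^sup>2) \<le> (\<Sum>z\<le>2*N+d. of_bool (z = 0) + (if z \<in> {1..2*N} then (real (rep_count S W z) - 1)\<^sup>2 else 0)
      + of_bool (N < z) * \<rho> ^ (2 * N))"
    by (intro sum_mono e2)
  also have "\<dots> = (\<Sum>z\<le>2*N+d. of_bool (z = 0)) + (\<Sum>z\<le>2*N+d. if z \<in> {1..2*N} then (real (rep_count S W z) - 1)\<^sup>2 else 0)
      + (\<Sum>z\<le>2*N+d. of_bool (N < z)) * \<rho> ^ (2 * N)"
    by (simp add: sum.distrib sum_distrib_right)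
  also have "(\<Sum>z\<le>2*N+d. of_bool (z = 0)) = (1::real)" by (simp add: of_bool_def)
  also have "(\<Sum>z\<le>2*N+d. if z \<in> {1..2*N} then (real (rep_count S W z) - 1)\<^sup>2 else 0) = \<Delta>"
    unfolding \<Delta>_def by (subst sum.inter_restrict [symmetric]) (auto intro!: sum.cong)
  also have "(\<Sum>z\<le>2*N+d. of_bool (N < z)) = (\<Sum>z\<in>{N<..2*N+d}. 1::real)"
    by (rule sum.mono_neutral_cong_right) auto
  finally have sum_e: "(\<Sum>z\<le>2*N+d. (e z)\<^sup>2) \<le> 1 + \<Delta> + real (N + d) * \<rho> ^ (2 * N)" by simp
  \<comment> \<open>The error is split off by \<open>square_diff_le\<close>, which costs a factor 2;
    its shifted difference costs another 4, whence the 8.\<close>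
  have "(\<Sum>z\<le>2*N+d. (f z - shift_by d f z)\<^sup>2) = (\<Sum>z\<le>2*N+d. ((p z - shift_by d p z) - - (e z - shift_by d e z))\<^sup>2)"
    by (intro sum.cong) (auto simp: e_def shift_by_def)
  also have "\<dots> \<le> (\<Sum>z\<le>2*N+d. 2 * (p z - shift_by d p z)\<^sup>2 + 2 * (- (e z - shift_by d e z))\<^sup>2)"
    by (intro sum_mono square_diff_le)
  also have "\<dots> = 2 * (\<Sum>z\<le>2*N+d. (p z - shift_by d p z)\<^sup>2) + 2 * (\<Sum>z\<le>2*N+d. (e z - shift_by d e z)\<^sup>2)"
    by (simp add: sum.distrib sum_distrib_left power2_commute)
  also have "\<dots> \<le> 2 * (2 * real d) + 2 * (4 * (\<Sum>z\<le>2*N+d. (e z)\<^sup>2))"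
    unfolding p_def using rho
    by (intro add_mono mult_left_mono sum_square_diff_shift_power_le sum_square_diff_shift_le) auto
  also have "\<dots> \<le> 4 * real d + 8 * (1 + \<Delta> + real (N + d) * \<rho> ^ (2 * N))"
    using sum_e by simp
  finally show ?thesis unfolding lag_form_sum_form f_def .
qed

text \<open>The trivial factor 4 for a shifted difference suffices, because the convolution lives on
  \<open>{1..2*h}\<close> and \<open>f\<^sup>2 \<le> 2 * (f - 1)\<^sup>2 + 2\<close>.\<close>

lemma lag_form_initial_le:
  fixes S W :: "nat set" and N :: nat
  assumes S: "S \<subseteq> {1..}" and "h \<le> N"
  defines "\<Delta> \<equiv> (\<Sum>n=1..2*N. (real (rep_count S W n) - 1)\<^sup>2)"
  shows "lag_form N d (indic {s\<in>S. s \<le> h}) (indic {w\<in>W. w \<le> h}) (indic {s\<in>S. s \<le> h}) (indic {w\<in>W. w \<le> h}) \<le> 16 * real h + 8 * \<Delta>"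
proof -
  define g where "g = conv N (indic {s\<in>S. s \<le> h}) (indic {w\<in>W. w \<le> h})"
  have g0: "0 \<le> g z" for z unfolding g_def by (rule conv_nonneg) auto
  have g1: "g z \<le> rep_count S W z" for z
    unfolding g_def by (rule order_trans [OF conv_mono conv_ind_le_rep_count]) auto
  have gz: "g z = 0" if "z = 0 \<or> 2 * h < z" for z
    using that S unfolding g_def by (intro conv_ind_eq_0) auto
  have g2: "(g z)\<^sup>2 \<le> (if z \<in> {1..2*h} then 2 + 2 * (real (rep_count S W z) - 1)\<^sup>2 else 0)" for z
  proof (cases "z \<in> {1..2*h}")
    case True
    have "(g z)\<^sup>2 \<le> (real (rep_count S W z))\<^sup>2" using g0 g1 by (intro power_mono)
    also have "\<dots> \<le> 2 * (real (rep_count S W z) - 1)\<^sup>2 + 2 * (-1)\<^sup>2"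
      using square_diff_le [of "real (rep_count S W z) - 1" "-1"] by simp
    finally show ?thesis using True by simp
  qed (use gz [of z] in auto)
  have "lag_form N d (indic {s\<in>S. s \<le> h}) (indic {w\<in>W. w \<le> h}) (indic {s\<in>S. s \<le> h}) (indic {w\<in>W. w \<le> h}) \<le> 4 * (\<Sum>z\<le>2*N+d. (g z)\<^sup>2)"
    unfolding lag_form_sum_form g_def by (rule sum_square_diff_shift_le)
  also have "(\<Sum>z\<le>2*N+d. (g z)\<^sup>2) \<le> (\<Sum>z\<le>2*N+d. if z \<in> {1..2*h} then 2 + 2 * (real (rep_count S W z) - 1)\<^sup>2 else 0)"
    by (intro sum_mono g2)
  also have "\<dots> = (\<Sum>z\<in>{1..2*h}. 2 + 2 * (real (rep_count S W z) - 1)\<^sup>2)"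
    using \<open>h \<le> N\<close> by (subst sum.inter_restrict [symmetric]) (auto intro!: sum.cong)
  also have "\<dots> = 4 * h + 2 * (\<Sum>z\<in>{1..2*h}. (real (rep_count S W z) - 1)\<^sup>2)"
    by (simp add: sum.distrib sum_distrib_left)
  also have "(\<Sum>z\<in>{1..2*h}. (real (rep_count S W z) - 1)\<^sup>2) \<le> \<Delta>"
    unfolding \<Delta>_def using \<open>h \<le> N\<close> by (intro sum_mono2) auto
  finally show ?thesis by simp
qed

text \<open>A nonzero product at \<open>z\<close> yields one representation with
  \<open>w \<le> h\<close> and one with \<open>s \<le> h\<close>. If \<open>z\<close> has a single
  representation, they coincide and \<open>z \<le> 2 * h\<close>; otherwise \<open>rep_count\<close>
  is at least 2 and its square is absorbed by \<open>\<Delta>\<close>.\<close>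

lemma sum_conv_mult_conv_le:
  fixes S W :: "nat set" and N :: nat
  assumes S: "S \<subseteq> {1..}" and "h \<le> N"
    and a: "\<And>x. 0 \<le> a x" "\<And>x. a x \<le> indic S x" and b: "\<And>x. 0 \<le> b x" "\<And>x. b x \<le> indic W x"
  defines "\<Delta> \<equiv> (\<Sum>n=1..2*N. (real (rep_count S W n) - 1)\<^sup>2)"
  shows "(\<Sum>z\<le>2*N. conv N a (indic {w\<in>W. w \<le> h}) z * conv N (indic {s\<in>S. s \<le> h}) b z) \<le> 2 * real h + 4 * \<Delta>"
proof -
  define u where "u = conv N a (indic {w\<in>W. w \<le> h})"
  define v where "v = conv N (indic {s\<in>S. s \<le> h}) b"
  define f where "f = (\<lambda>z. real (rep_count S W z))"
  have u0: "0 \<le> u z" and v0: "0 \<le> v z" for z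
    unfolding u_def v_def using a b by (auto intro!: conv_nonneg)
  have u1: "u z \<le> conv N (indic S) (indic {w\<in>W. w \<le> h}) z" and v1: "v z \<le> conv N (indic {s\<in>S. s \<le> h}) (indic W) z" for z
    unfolding u_def v_def using a b by (auto intro!: conv_mono)
  have u2: "u z \<le> f z" and v2: "v z \<le> f z" for z
    unfolding f_def
    by (rule order_trans [OF order_trans [OF u1 conv_mono] conv_ind_le_rep_count]; auto)
       (rule order_trans [OF order_trans [OF v1 conv_mono] conv_ind_le_rep_count]; auto)
  have uv: "u z * v z \<le> (if z \<in> {1..2*N} then of_bool (z \<le> 2 * h) + 4 * (f z - 1)\<^sup>2 else 0)" if "z \<le> 2 * N" for z
  proof -
    have le: "u z * v z \<le> f z * f z"
      using u0 v0 u2 v2 by (intro mult_mono) (auto simp: f_def)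
    consider "rep_count S W z = 0" | "rep_count S W z = 1" | "rep_count S W z \<ge> 2" by linarith
    then show ?thesis
    proof cases
      case 1
      then have "u z * v z \<le> 0" using le by (simp add: f_def)
      then show ?thesis by (rule order_trans) simp
    next
      case 2
      then have z: "z \<noteq> 0" using rep_count_0 [OF S] by (metis zero_neq_one)
      show ?thesis
      proof (cases "u z * v z = 0")
        case True
        show ?thesis unfolding True by simp
      next
        case False
        then have "conv N (indic S) (indic {w\<in>W. w \<le> h}) z \<noteq> 0" "conv N (indic {s\<in>S. s \<le> h}) (indic W) z \<noteq> 0"
          using u0 [of z] v0 [of z] u1 [of z] v1 [of z] by auto
        then have "{(s, w) \<in> S \<times> {w\<in>W. w \<le> h}. z = s + w \<and> s \<le> N \<and> w \<le> N} \<noteq> {}"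
          "{(s, w) \<in> {s\<in>S. s \<le> h} \<times> W. z = s + w \<and> s \<le> N \<and> w \<le> N} \<noteq> {}"
          unfolding conv_ind by (metis card.empty of_nat_0)+
        then obtain s w s' w' where *: "s \<in> S" "w \<in> W" "w \<le> h" "z = s + w" "s' \<in> S" "w' \<in> W" "s' \<le> h" "z = s' + w'"
          by auto
        from 2 obtain x where "{(s, w) \<in> S \<times> W. z = s + w} = {x}"
          unfolding rep_count_def by (auto simp: card_1_singleton_iff)
        moreover have "(s, w) \<in> {(s, w) \<in> S \<times> W. z = s + w}" "(s', w') \<in> {(s, w) \<in> S \<times> W. z = s + w}"
          using * by auto
        ultimately have "s = s'" by auto
        with * have "z \<le> 2 * h" by auto
        then show ?thesis using le 2 z that by (simp add: f_def)
      qed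
    next
      case 3
      then have z: "z \<noteq> 0" using rep_count_0 [OF S] by (metis not_numeral_le_zero)
      \<comment> \<open>This is \<open>4 * (f z - 1)\<^sup>2 - f z * f z\<close> in factored
        form.\<close>
      have "0 \<le> (f z - 2) * (3 * f z - 2)" using 3 by (intro mult_nonneg_nonneg) (auto simp: f_def)
      then have "f z * f z \<le> 4 * (f z - 1)\<^sup>2"
        by (simp add: power2_eq_square algebra_simps)
      then show ?thesis using le z that by simp
    qed
  qed
  have "(\<Sum>z\<le>2*N. u z * v z) \<le> (\<Sum>z\<le>2*N. if z \<in> {1..2*N} then of_bool (z \<le> 2 * h) + 4 * (f z - 1)\<^sup>2 else 0)"
    by (intro sum_mono uv) simp
  also have "\<dots> = (\<Sum>z=1..2*N. of_bool (z \<le> 2 * h) + 4 * (f z - 1)\<^sup>2)"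
    by (subst sum.inter_restrict [symmetric]) (auto intro!: sum.cong)
  also have "\<dots> = (\<Sum>z=1..2*N. of_bool (z \<le> 2 * h)) + 4 * \<Delta>"
    by (simp add: sum.distrib sum_distrib_left \<Delta>_def f_def)
  also have "(\<Sum>z=1..2*N. of_bool (z \<le> 2 * h)) = real (card ({1..2*N} \<inter> {z. z \<le> 2 * h}))"
    by (simp add: of_bool_def sum.If_cases)
  also have "card ({1..2*N} \<inter> {z. z \<le> 2 * h}) \<le> card {1..2*h}"
    by (intro card_mono) auto
  finally show ?thesis unfolding u_def v_def by simp
qed

section \<open>The contribution of the dyadic scales\<close>

lemma sum_of_bool_add_eq:
  fixes x y :: nat
  shows "(\<Sum>d=1..L. of_bool (x + d = y)) = (of_bool (x < y \<and> y \<le> x + L) :: real)"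
proof -
  have "(\<Sum>d=1..L. of_bool (x + d = y)) = (\<Sum>d=1..L. if d = y - x then of_bool (x < y) else (0::real))"
    by (intro sum.cong) auto
  also have "\<dots> = of_bool (x < y \<and> y \<le> x + L)" by (auto simp: Suc_le_eq)
  finally show ?thesis .
qed

text \<open>For fixed \<open>w\<close>, \<open>s'\<close>, \<open>w'\<close> the sum over the lags
  counts the \<open>s\<close> in a window of length \<open>L\<close> below
  \<open>y = s' + w' - w\<close>, and \<open>y\<close> is within \<open>h\<close> of
  \<open>w'\<close>. The lower bound \<open>m\<close> depends on \<open>w'\<close> alone, so the
  sums over \<open>w\<close> and \<open>s'\<close> give the two cardinalities. The weights cost
  \<open>\<rho> ^ (K + h)\<close> for \<open>s\<close> and \<open>\<rho> ^ K\<close> for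
  \<open>w'\<close>.\<close>

lemma sum_lag_corr_ge:
  fixes S W :: "nat set" and \<rho> :: real and m :: "nat \<Rightarrow> real"
  assumes rho: "0 \<le> \<rho>" "\<rho> \<le> 1" and "K + h \<le> N"
    and m: "\<And>w y. \<lbrakk>w \<in> W; 3 * h < w; w \<le> K; w \<le> y + h; y \<le> w + h\<rbrakk> \<Longrightarrow> m w \<le> real (card (S \<inter> {y-L..<y}))"
    and m0: "\<And>w. 0 \<le> m w"
  shows "real (card {s\<in>S. s \<le> h}) * real (card {w\<in>W. w \<le> h}) * \<rho> ^ (2 * K + h) * (\<Sum>w\<in>{w\<in>W. 3*h < w \<and> w \<le> K}. m w)
     \<le> (\<Sum>d=1..L. lag_corr N d (\<lambda>x. indic S x * \<rho> ^ x) (indic {w\<in>W. w \<le> h}) (indic {s\<in>S. s \<le> h}) (\<lambda>x. indic W x * \<rho> ^ x))"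
    (is "?l \<le> ?r")
proof -
  let ?A = "{s\<in>S. s \<le> h}" and ?B = "{w\<in>W. w \<le> h}" and ?C = "{w\<in>W. 3*h < w \<and> w \<le> K}"
  let ?I = "\<lambda>w s' w'. (\<Sum>d=1..L. \<Sum>s\<le>N. indic S s * \<rho> ^ s * of_bool (s + w + d = s' + w'))"
  have I: "m w' * \<rho> ^ (K + h) \<le> ?I w s' w'" if w: "w \<in> ?B" "s' \<in> ?A" "w' \<in> ?C" for w s' w'
  proof -
    define y where "y = s' + w' - w"
    have y: "w' \<le> y + h" "y \<le> w' + h" "s' + w' = y + w" using w unfolding y_def by auto
    have "?I w s' w' = (\<Sum>s\<le>N. \<Sum>d=1..L. indic S s * \<rho> ^ s * of_bool (s + w + d = s' + w'))"
      by (rule sum.swap)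
    also have "\<dots> = (\<Sum>s\<le>N. indic S s * \<rho> ^ s * of_bool (s + w < s' + w' \<and> s' + w' \<le> s + w + L))"
      unfolding sum_distrib_left [symmetric] sum_of_bool_add_eq ..
    also have "\<dots> \<ge> (\<Sum>s\<in>S \<inter> {y-L..<y}. indic S s * \<rho> ^ s * of_bool (s + w < s' + w' \<and> s' + w' \<le> s + w + L))"
      using rho y w assms(3) by (intro sum_mono2) auto
    moreover have "(\<Sum>s\<in>S \<inter> {y-L..<y}. indic S s * \<rho> ^ s * of_bool (s + w < s' + w' \<and> s' + w' \<le> s + w + L))
       \<ge> (\<Sum>s\<in>S \<inter> {y-L..<y}. \<rho> ^ (K + h))"
    proof (intro sum_mono)
      fix s assume s: "s \<in> S \<inter> {y-L..<y}"
      then have "\<rho> ^ (K + h) \<le> \<rho> ^ s" using rho y w by (intro power_decreasing) auto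
      then show "\<rho> ^ (K + h) \<le> indic S s * \<rho> ^ s * of_bool (s + w < s' + w' \<and> s' + w' \<le> s + w + L)"
        using s y by auto
    qed
    moreover have "(\<Sum>s\<in>S \<inter> {y-L..<y}. \<rho> ^ (K + h)) \<ge> m w' * \<rho> ^ (K + h)"
      using m [of w' y] w y rho by (auto intro!: mult_right_mono)
    ultimately show ?thesis by linarith
  qed
  have ind_sum: "(\<Sum>x\<le>N. indic D x * F x) = (\<Sum>x\<in>D. F x)" if "D \<subseteq> {..N}" for D F
    using that by (subst sum.mono_neutral_right [of "{..N}" D]) auto
  have sub: "?A \<subseteq> {..N}" "?B \<subseteq> {..N}" "?C \<subseteq> {..N}" using assms(3) by auto
  have "?l = (\<Sum>w\<le>N. indic ?B w * (\<Sum>s'\<le>N. indic ?A s' * (\<Sum>w'\<le>N. indic ?C w' * (m w' * \<rho> ^ (2 * K + h)))))"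
    by (simp only: ind_sum [OF sub(1)] ind_sum [OF sub(2)] ind_sum [OF sub(3)])
      (simp add: sum_distrib_right [symmetric])
  also have "\<dots> = (\<Sum>w\<le>N. \<Sum>s'\<le>N. \<Sum>w'\<le>N. indic ?B w * (indic ?A s' * (indic ?C w' * (m w' * \<rho> ^ (2 * K + h)))))"
    by (simp only: sum_distrib_left)
  also have "\<dots> \<le> (\<Sum>w\<le>N. \<Sum>s'\<le>N. \<Sum>w'\<le>N. indic ?B w * indic ?A s' * (indic W w' * \<rho> ^ w') * ?I w s' w')"
  proof (intro sum_mono)
    fix w s' w' assume "w' \<in> {..N}"
    have I0: "0 \<le> ?I w s' w'" using rho by (intro sum_nonneg) auto
    show "indic ?B w * (indic ?A s' * (indic ?C w' * (m w' * \<rho> ^ (2 * K + h)))) \<le> indic ?B w * indic ?A s' * (indic W w' * \<rho> ^ w') * ?I w s' w'"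
    proof (cases "w \<in> ?B \<and> s' \<in> ?A \<and> w' \<in> ?C")
      case True
      have "m w' * \<rho> ^ (2 * K + h) = \<rho> ^ K * (m w' * \<rho> ^ (K + h))"
        by (simp add: power_add mult_2)
      also have "\<dots> \<le> \<rho> ^ w' * ?I w s' w'"
        using I [of w s' w'] True rho m0 by (intro mult_mono power_decreasing) auto
      finally show ?thesis using True by simp
    next
      case False
      then have "indic ?B w * (indic ?A s' * (indic ?C w' * (m w' * \<rho> ^ (2 * K + h)))) = 0" by auto
      moreover have "0 \<le> indic ?B w * indic ?A s' * (indic W w' * \<rho> ^ w') * ?I w s' w'"
        using I0 rho by (intro mult_nonneg_nonneg) auto
      ultimately show ?thesis by linarith
    qed
  qed
  also have "\<dots> = ?r"
  \<comment> \<open>Only the order of summation differs: the lag and \<open>s\<close> have to be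
    moved innermost.\<close>
  proof -
    have "?r = (\<Sum>d=1..L. \<Sum>w\<le>N. \<Sum>s'\<le>N. \<Sum>w'\<le>N. \<Sum>s\<le>N.
      indic ?B w * indic ?A s' * (indic W w' * \<rho> ^ w') * (indic S s * \<rho> ^ s * of_bool (s + w + d = s' + w')))"
    proof (rule sum.cong [OF refl])
      fix d
      let ?g = "\<lambda>s w s' w'. indic ?B w * indic ?A s' * (indic W w' * \<rho> ^ w') * (indic S s * \<rho> ^ s * of_bool (s + w + d = s' + w'))"
      have "lag_corr N d (\<lambda>x. indic S x * \<rho> ^ x) (indic ?B) (indic ?A) (\<lambda>x. indic W x * \<rho> ^ x) = (\<Sum>s\<le>N. \<Sum>w\<le>N. \<Sum>s'\<le>N. \<Sum>w'\<le>N. ?g s w s' w')"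
        unfolding lag_corr_def by (simp only: mult_ac)
      also have "\<dots> = (\<Sum>w\<le>N. \<Sum>s\<le>N. \<Sum>s'\<le>N. \<Sum>w'\<le>N. ?g s w s' w')"
        by (rule sum.swap)
      also have "\<dots> = (\<Sum>w\<le>N. \<Sum>s'\<le>N. \<Sum>s\<le>N. \<Sum>w'\<le>N. ?g s w s' w')"
        by (rule sum.cong [OF refl], rule sum.swap)
      also have "\<dots> = (\<Sum>w\<le>N. \<Sum>s'\<le>N. \<Sum>w'\<le>N. \<Sum>s\<le>N. ?g s w s' w')"
        by (rule sum.cong [OF refl], rule sum.cong [OF refl], rule sum.swap)
      finally show "lag_corr N d (\<lambda>x. indic S x * \<rho> ^ x) (indic ?B) (indic ?A) (\<lambda>x. indic W x * \<rho> ^ x) = \<dots>" .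
    qed
    also have "\<dots> = (\<Sum>w\<le>N. \<Sum>d=1..L. \<Sum>s'\<le>N. \<Sum>w'\<le>N. \<Sum>s\<le>N.
      indic ?B w * indic ?A s' * (indic W w' * \<rho> ^ w') * (indic S s * \<rho> ^ s * of_bool (s + w + d = s' + w')))"
      by (rule sum.swap)
    also have "\<dots> = (\<Sum>w\<le>N. \<Sum>s'\<le>N. \<Sum>d=1..L. \<Sum>w'\<le>N. \<Sum>s\<le>N.
      indic ?B w * indic ?A s' * (indic W w' * \<rho> ^ w') * (indic S s * \<rho> ^ s * of_bool (s + w + d = s' + w')))"
      by (rule sum.cong [OF refl], rule sum.swap)
    also have "\<dots> = (\<Sum>w\<le>N. \<Sum>s'\<le>N. \<Sum>w'\<le>N. \<Sum>d=1..L. \<Sum>s\<le>N.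
      indic ?B w * indic ?A s' * (indic W w' * \<rho> ^ w') * (indic S s * \<rho> ^ s * of_bool (s + w + d = s' + w')))"
      by (rule sum.cong [OF refl], rule sum.cong [OF refl], rule sum.swap)
    finally show ?thesis by (simp only: sum_distrib_left)
  qed
  finally show ?thesis .
qed

section \<open>Counting functions and sums of representation numbers\<close>

lemma counting_of_nat: "counting A (real n) = card (A \<inter> {1..n})"
  unfolding counting_def by (intro arg_cong [where f=card]) auto

lemma sum_rep_count_eq:
  assumes "S \<subseteq> {1..}"
  shows "(\<Sum>n=1..x. rep_count S W n) = card {(s, w) \<in> S \<times> W. s + w \<le> x}"
proof -
  have "(\<Sum>n=1..x. rep_count S W n) = card (\<Union>n\<in>{1..x}. {(s, w) \<in> S \<times> W. n = s + w})"
    unfolding rep_count_def by (intro card_UN_disjoint [symmetric] ballI impI finite_reps) auto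
  also have "(\<Union>n\<in>{1..x}. {(s, w) \<in> S \<times> W. n = s + w}) = {(s, w) \<in> S \<times> W. s + w \<le> x}"
    using assms by fastforce
  finally show ?thesis .
qed

lemma sum_rep_count_le:
  assumes "S \<subseteq> {1..}" "W \<subseteq> {1..}"
  shows "(\<Sum>n=1..x. rep_count S W n) \<le> counting S (real x) * counting W (real x)"
  unfolding sum_rep_count_eq [OF assms(1)] counting_of_nat card_cartesian_product [symmetric]
  using assms by (intro card_mono) force+

text \<open>Two elements up to \<open>x\<close> have sum at most \<open>2 * x\<close>. With
  \<open>sum_rep_count_le\<close>, this turns knowledge of \<open>S\<close> and
  \<open>rep_count\<close> into bounds for \<open>W\<close>.\<close>

lemma sum_rep_count_ge:
  assumes "S \<subseteq> {1..}"
  shows "counting S (real x) * counting W (real x) \<le> (\<Sum>n=1..2*x. rep_count S W n)"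
  unfolding sum_rep_count_eq [OF assms(1)] counting_of_nat card_cartesian_product [symmetric]
proof (intro card_mono)
  show "finite {(s, w). (s, w) \<in> S \<times> W \<and> s + w \<le> 2 * x}"
    by (rule finite_subset [of _ "{..2*x} \<times> {..2*x}"]) auto
qed auto

lemma rep_count_le_counting:
  assumes "S \<subseteq> {1..}" "n \<le> x"
  shows "rep_count S W n \<le> counting S (real x)"
proof -
  have "rep_count S W n = card (fst ` {(s, w) \<in> S \<times> W. n = s + w})"
    unfolding rep_count_def by (rule card_image [symmetric]) (auto simp: inj_on_def)
  also have "\<dots> \<le> card (S \<inter> {1..x})"
    using assms by (intro card_mono) auto
  finally show ?thesis unfolding counting_of_nat .
qed

section \<open>Elements of \<open>S\<close> in short windows\<close>

lemma powr_diff_ge: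
  fixes x l q :: real
  assumes "0 < l" "l < x" "0 < q" "q \<le> 1"
  shows "q * l * x powr (q - 1) \<le> x powr q - (x - l) powr q"
proof -
  have "\<exists>z. x - l < z \<and> z < x \<and> x powr q - (x - l) powr q = (x - (x - l)) * (q * z powr (q - 1))"
    using assms by (intro MVT2) (auto intro!: derivative_eq_intros)
  then obtain z where z: "x - l < z" "z < x" "x powr q - (x - l) powr q = l * (q * z powr (q - 1))" by auto
  have "x powr (q - 1) \<le> z powr (q - 1)"
    using assms z by (intro powr_mono2') auto
  then show ?thesis using z assms by (simp add: mult_ac)
qed

lemma counting_window:
  "L \<le> x \<Longrightarrow> real (counting A (real x)) - real (counting A (real (x - L))) = real (card (A \<inter> {x + 1 - L..<x + 1}))"
proof -
  assume "L \<le> x"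
  have "card (A \<inter> {1..x}) = card ((A \<inter> {1..x-L}) \<union> (A \<inter> {x + 1 - L..<x + 1}))"
    using \<open>L \<le> x\<close> by (intro arg_cong [where f=card]) auto
  also have "\<dots> = card (A \<inter> {1..x-L}) + card (A \<inter> {x + 1 - L..<x + 1})"
    by (rule card_Un_disjoint) auto
  finally show ?thesis unfolding counting_of_nat by simp
qed

text \<open>By the mean value theorem the main term is at least half of
  \<open>c * q * L * w powr (q - 1)\<close>, and the two errors together cost at most a quarter. The
  tolerance is made for this: 6400 is 8 times the 800 in \<open>h \<le> 800 * L\<close>, and
  \<open>R\<close> accounts for \<open>w\<close> being as large as \<open>R * h\<close>.\<close>

lemma card_window_ge:
  fixes S :: "nat set" and c q :: real
  assumes q: "0 < q" "q \<le> 1/2" and c: "0 < c" and h: "0 < h" and L: "0 < L" "L \<le> h" "h \<le> 800 * L"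
    and asym: "\<And>x. h \<le> x \<Longrightarrow> x \<le> 2 * (R * h) \<Longrightarrow>
       \<bar>real (counting S (real x)) - c * real x powr q\<bar> \<le> q / (6400 * real R) * c * real h powr q"
    and w: "3 * h < w" "w \<le> R * h" and y: "w \<le> y + h" "y \<le> w + h"
  shows "c * q * real L / 4 * real w powr (q - 1) \<le> real (card (S \<inter> {y-L..<y}))"
proof -
  \<comment> \<open>\<open>counting\<close> includes its endpoint, while the window stops before
    \<open>y\<close>. Because of \<open>3 * h < w\<close>, both \<open>x\<close> and
    \<open>x - L\<close> are at least \<open>h\<close>, where \<open>asym\<close> applies.\<close>
  define x where "x = y - 1"
  have x: "2 * h \<le> x" "x \<le> 2 * w" "x \<le> 2 * (R * h)" "y = x + 1" "h \<le> x - L" "x - L \<le> 2 * (R * h)" "L \<le> x"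
    using w y h L unfolding x_def by auto
  have R: "1 \<le> R" using w h by (cases R) auto
  define \<tau> where "\<tau> = q / (6400 * real R) * c * real h powr q"
  have "real (card (S \<inter> {y-L..<y})) = real (counting S (real x)) - real (counting S (real (x - L)))"
    using counting_window [OF x(7)] x(4) by simp
  also have "\<dots> \<ge> (c * real x powr q - \<tau>) - (c * real (x - L) powr q + \<tau>)"
    using asym [of x] asym [of "x - L"] x h unfolding \<tau>_def by (intro diff_mono) auto
  finally have 1: "c * (real x powr q - (real x - real L) powr q) - 2 * \<tau> \<le> real (card (S \<inter> {y-L..<y}))"
    using x by (simp add: algebra_simps of_nat_diff)
  have "q * real L * (2 * real w) powr (q - 1) \<le> q * real L * real x powr (q - 1)"
    using q x h L by (intro mult_left_mono powr_mono2') auto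
  also have "\<dots> \<le> real x powr q - (real x - real L) powr q"
    using q x h L by (intro powr_diff_ge) auto
  finally have 2: "q * real L * (2 * real w) powr (q - 1) \<le> real x powr q - (real x - real L) powr q" .
  have "(1/2::real) = 2 powr (-1)" by (simp add: powr_minus)
  also have "\<dots> \<le> 2 powr (q - 1)" using q by (intro powr_mono) auto
  finally have "1/2 * real w powr (q - 1) \<le> 2 powr (q - 1) * real w powr (q - 1)"
    by (intro mult_right_mono) auto
  also have "\<dots> = (2 * real w) powr (q - 1)"
    by (simp add: powr_mult)
  finally have "q * real L * (1/2 * real w powr (q - 1)) \<le> q * real L * (2 * real w) powr (q - 1)"
    using q by (intro mult_left_mono) auto
  with 2 have 3: "c * (q * real L * (1/2 * real w powr (q - 1))) \<le> c * (real x powr q - (real x - real L) powr q)"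
    using c by (intro mult_left_mono) auto
  \<comment> \<open>The error is compared with the main term at \<open>w = R * h\<close>, where
    \<open>w powr (q - 1)\<close> is smallest.\<close>
  have "real h powr q / real R = real h powr (q - 1) * real h / real R"
    using h by (simp add: powr_diff)
  also have "\<dots> \<le> real h powr (q - 1) * real h * real R powr (q - 1)"
  proof -
    have "1 / real R = real R powr (-1)" using R by (simp add: powr_minus divide_inverse)
    also have "\<dots> \<le> real R powr (q - 1)" using R q by (intro powr_mono) auto
    finally have "real h powr (q - 1) * real h * (1 / real R) \<le> real h powr (q - 1) * real h * real R powr (q - 1)"
      by (intro mult_left_mono) auto
    then show ?thesis by simp
  qed
  also have "\<dots> = real (R * h) powr (q - 1) * real h"
    by (simp add: powr_mult)
  also have "\<dots> \<le> real w powr (q - 1) * (800 * real L)"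
    using w q L h by (intro mult_mono powr_mono2') (auto simp del: of_nat_mult)
  finally have "q * c / 6400 * (real h powr q / real R) \<le> q * c / 6400 * (real w powr (q - 1) * (800 * real L))"
    using q c by (intro mult_left_mono) auto
  then have "\<tau> \<le> c * q * real L / 8 * real w powr (q - 1)"
    unfolding \<tau>_def by (simp add: field_simps)
  with 1 3 show ?thesis by (simp add: field_simps)
qed

text \<open>The block from \<open>H\<close> to \<open>64 * H\<close> holds at least
  \<open>H powr (1 - q) / c\<close> elements of \<open>W\<close>, each of weight at least
  \<open>H powr (q - 1) / 64\<close>. The powers of \<open>H\<close> cancel, so every block
  contributes at least the same constant; this is the source of the logarithm.\<close>

lemma sum_powr_dyadic_ge:
  fixes W :: "nat set" and c q :: real
  assumes q: "0 < q" "q \<le> 1/2" and c: "0 < c" and h: "1 \<le> h"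
    and step: "\<And>i. i \<in> {1..J} \<Longrightarrow>
       real (64 ^ i * h) powr (1 - q) / c \<le> real (counting W (real (64 ^ (i+1) * h))) - real (counting W (real (64 ^ i * h)))"
  shows "real J / (64 * c) \<le> (\<Sum>w\<in>{w\<in>W. 64 * h < w \<and> w \<le> 64 ^ (J+1) * h}. real w powr (q - 1))"
  using step
proof (induction J)
  case 0
  then show ?case by (auto intro: sum_nonneg)
next
  case (Suc J)
  define H where "H = 64 ^ (Suc J) * h"
  let ?A = "\<lambda>a b. {w\<in>W. a < w \<and> w \<le> b}"
  have H: "1 \<le> H" "64 * h \<le> H" using h unfolding H_def by auto
  have "real (64 ^ Suc J * h) powr (1 - q) / c \<le> real (counting W (real (64 ^ (Suc J + 1) * h))) - real (counting W (real (64 ^ Suc J * h)))"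
    by (rule Suc.prems) simp
  then have *: "real H powr (1 - q) / c \<le> real (counting W (real (64 * H))) - real (counting W (real H))"
    unfolding H_def by (simp add: mult_ac)
  also have "real (counting W (real (64 * H))) - real (counting W (real H)) = real (card (?A H (64 * H)))"
  proof -
    have "card (W \<inter> {1..64*H}) = card ((W \<inter> {1..H}) \<union> ?A H (64 * H))"
      by (intro arg_cong [where f=card]) auto
    also have "\<dots> = card (W \<inter> {1..H}) + card (?A H (64 * H))"
      by (rule card_Un_disjoint) auto
    finally show ?thesis unfolding counting_of_nat by simp
  qed
  finally have card: "real H powr (1 - q) / c \<le> real (card (?A H (64 * H)))" .
  have "1 / (64 * c) = real H powr (1 - q) / c * (1 / 64 * real H powr (q - 1))"
    using H by (simp add: powr_diff field_simps)
  also have "\<dots> \<le> real (card (?A H (64 * H))) * (1 / 64 * real H powr (q - 1))"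
    using card by (intro mult_right_mono) auto
  also have "\<dots> = (\<Sum>w\<in>?A H (64 * H). 1 / 64 * real H powr (q - 1))" by simp
  also have "\<dots> \<le> (\<Sum>w\<in>?A H (64 * H). real w powr (q - 1))"
  proof (intro sum_mono)
    fix w assume w: "w \<in> ?A H (64 * H)"
    have "1/64 = 64 powr (-1::real)" by (simp add: powr_minus)
    also have "\<dots> \<le> 64 powr (q - 1)" using q by (intro powr_mono) auto
    finally have "1/64 * real H powr (q - 1) \<le> 64 powr (q - 1) * real H powr (q - 1)"
      by (intro mult_right_mono) auto
    also have "\<dots> = real (64 * H) powr (q - 1)" by (simp add: powr_mult)
    also have "\<dots> \<le> real w powr (q - 1)" using w q H by (intro powr_mono2') auto
    finally show "1/64 * real H powr (q - 1) \<le> real w powr (q - 1)" .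
  qed
  finally have new: "1 / (64 * c) \<le> (\<Sum>w\<in>?A H (64 * H). real w powr (q - 1))" .
  have eq: "64 ^ (Suc J + 1) * h = 64 * H" by (simp add: H_def)
  have "?A (64 * h) (64 * H) = ?A (64 * h) H \<union> ?A H (64 * H)"
    using H(2) by auto
  moreover have "sum F (?A (64 * h) H \<union> ?A H (64 * H)) = sum F (?A (64 * h) H) + sum F (?A H (64 * H))" for F :: "nat \<Rightarrow> real"
    by (rule sum.union_disjoint) auto
  ultimately have "(\<Sum>w\<in>{w\<in>W. 64 * h < w \<and> w \<le> 64 ^ (Suc J + 1) * h}. real w powr (q - 1))
     = (\<Sum>w\<in>?A (64 * h) H. real w powr (q - 1)) + (\<Sum>w\<in>?A H (64 * H). real w powr (q - 1))"
    unfolding eq by metis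
  moreover have "real J / (64 * c) \<le> (\<Sum>w\<in>?A (64 * h) H. real w powr (q - 1))"
    using Suc unfolding H_def by simp
  ultimately show ?case using new by (simp add: add_divide_distrib)
qed

text \<open>The hypotheses give \<open>W\<close> order \<open>x powr (1 - q) / c\<close> at both
  ends of the block. Since \<open>64 powr (1 - q) \<ge> 8\<close>, the ratio 64 makes the lower
  bound at \<open>64 * H\<close> exceed the upper bound at \<open>H\<close> despite the constants
  lost.\<close>

lemma counting_dyadic_ge:
  fixes S W :: "nat set" and c q :: real
  assumes q: "0 < q" "q \<le> 1/2" and c: "0 < c" and S: "S \<subseteq> {1..}" and W: "W \<subseteq> {1..}" and h: "0 < H"
    and s1: "9/10 * c * real H powr q \<le> real (counting S (real H))"
    and s2: "real (counting S (real (64 * H))) \<le> 11/10 * c * real (64 * H) powr q"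
    and f1: "(\<Sum>n=1..2*H. real (rep_count S W n)) \<le> 21/10 * real H"
    and f2: "63 * real H \<le> (\<Sum>n=1..64*H. real (rep_count S W n))"
  shows "real H powr (1 - q) / c \<le> real (counting W (real (64 * H))) - real (counting W (real H))"
proof -
  have "real (counting S (real H) * counting W (real H)) \<le> real (\<Sum>n=1..2*H. rep_count S W n)"
    by (rule of_nat_mono [OF sum_rep_count_ge [OF S]])
  then have up0: "real (counting S (real H)) * real (counting W (real H)) \<le> 21/10 * real H"
    using f1 by simp
  have "9/10 * c * real H powr q * real (counting W (real H)) \<le> real (counting S (real H)) * real (counting W (real H))"
    using s1 by (intro mult_right_mono) auto
  also have "\<dots> \<le> 21/10 * real H"
    by (rule up0)
  finally have "real (counting W (real H)) \<le> 21/10 * real H / (9/10 * c * real H powr q)"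
    using c h by (simp add: field_simps)
  then have up: "real (counting W (real H)) \<le> 21/9 * (real H powr (1 - q) / c)"
    using h c by (simp add: powr_diff field_simps)
  have "63 * real H \<le> real (counting S (real (64 * H))) * real (counting W (real (64 * H)))"
    using f2 of_nat_mono [OF sum_rep_count_le [OF S W, of "64 * H"], where 'a=real] by simp
  also have "\<dots> \<le> 11/10 * c * real (64 * H) powr q * real (counting W (real (64 * H)))"
    using s2 by (intro mult_right_mono) auto
  finally have "63 * real H / (11/10 * c * real (64 * H) powr q) \<le> real (counting W (real (64 * H)))"
    using c h by (simp add: field_simps)
  moreover have "630/(64 * 11) * (64 powr (1 - q)) * (real H powr (1 - q) / c) = 63 * real H / (11/10 * c * real (64 * H) powr q)"
    using h c by (simp add: powr_diff powr_mult field_simps)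
  moreover have "(8::real) \<le> 64 powr (1 - q)"
  proof -
    have "(8::real) = sqrt 64" by (simp add: real_sqrt_unique)
    also have "\<dots> = 64 powr (1/2)" by (simp add: powr_half_sqrt)
    also have "\<dots> \<le> 64 powr (1 - q)" using q by (intro powr_mono) auto
    finally show ?thesis .
  qed
  then have "630/(64 * 11) * 8 * (real H powr (1 - q) / c) \<le> 630/(64 * 11) * (64 powr (1 - q)) * (real H powr (1 - q) / c)"
    using c by (intro mult_right_mono mult_left_mono) auto
  moreover have "0 \<le> real H powr (1 - q) / c" using c by simp
  \<comment> \<open>Numerically \<open>630 * 8 / (64 * 11)\<close> exceeds 7, while
    \<open>21/9\<close> is below 3.\<close>
  ultimately have "630/(64*11) * 8 * (real H powr (1 - q) / c) - 21/9 * (real H powr (1 - q) / c) \<le> real (counting W (real (64 * H))) - real (counting W (real H))"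
    using up by linarith
  moreover have "real H powr (1 - q) / c \<le> 630/(64*11) * 8 * (real H powr (1 - q) / c) - 21/9 * (real H powr (1 - q) / c)"
    using \<open>0 \<le> real H powr (1 - q) / c\<close> by simp
  ultimately show ?thesis by linarith
qed

section \<open>The contradiction\<close>

text \<open>
  There are \<open>J\<close> scales of ratio \<open>64\<close>, so that \<open>2 \<cdot> 27 \<cdot> 4 \<cdot> 64 = 13824\<close> is the total loss in the lower bound,
  and \<open>J = 8 \<cdot> 13824 r\<close> makes the averaged correlation at least \<open>8 h\<close>; the upper bound is \<open>6 h\<close>.
\<close>

lemma no_almost_tiling:
  fixes S W :: "nat set" and c :: real and r J R K N X h n0 :: nat
  assumes r: "2 \<le> r" and c: "0 < c" and S: "S \<subseteq> {1..}" and W: "W \<subseteq> {1..}"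
    and J: "J = 110592 * r" and R: "R = 64 ^ (J + 1)" and K: "K = R * h" and N: "N = X * K"
    and X: "2 \<le> X" "16 * real X * real R * exp (- 2 * real X) \<le> 1/100"
    and h: "8000 \<le> h" "100 * n0 \<le> h"
    and n0: "\<And>n. n0 \<le> n \<Longrightarrow> 1 \<le> rep_count S W n"
    and asym: "\<And>x. h \<le> x \<Longrightarrow> x \<le> 2 * K \<Longrightarrow>
       \<bar>real (counting S (real x)) - c * real x powr (1 / real r)\<bar> \<le> 1 / real r / (6400 * real R) * c * real h powr (1 / real r)"
    and \<Delta>: "(\<Sum>n=1..2*N. (real (rep_count S W n) - 1)\<^sup>2) \<le> real h / 1000"
  shows False
proof -
  define q where "q = 1 / real r"
  \<comment> \<open>Keeps the loss \<open>4 * real d\<close> from the lag at most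
    \<open>h / 100\<close>.\<close>
  define L where "L = h div 400"
  \<comment> \<open>The weight stays bounded below up to a multiple of \<open>K\<close>, the range
    that contributes, and is negligible at \<open>N = X * K\<close>.\<close>
  define \<rho> where "\<rho> = exp (- 1 / real K)"
  define D where "D = (\<Sum>n=1..2*N. (real (rep_count S W n) - 1)\<^sup>2)"
  have q: "0 < q" "q \<le> 1/2" using r by (auto simp: q_def field_simps)
  have L: "0 < L" "L \<le> h" "h \<le> 800 * L" "400 * L \<le> h" using h unfolding L_def by linarith+
  have "64 ^ 1 \<le> (64::nat) ^ (J + 1)" by (rule power_increasing) auto
  then have R64: "64 \<le> R" unfolding R by simp
  then have K64: "64 * h \<le> K" unfolding K by simp
  have K0: "0 < K" using K64 h by simp
  have NK: "2 * K \<le> N" unfolding N using X by simp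
  have hN: "h \<le> N" "K + h \<le> N" using NK K64 by auto
  have rho: "0 \<le> \<rho>" "\<rho> \<le> 1" "0 < \<rho>" unfolding \<rho>_def by auto
  have rho_pow: "\<rho> ^ n = exp (- real n / real K)" for n
    unfolding \<rho>_def exp_of_nat_mult [symmetric] by simp
  have D: "D \<le> real h / 1000" using \<Delta> unfolding D_def .

  \<comment> \<open>A natural number \<open>f\<close> satisfies
    \<open>f - 1 \<le> (f - 1)\<^sup>2\<close>, so a small mean square bounds the sums from above as
    well.\<close>
  have f_le: "(\<Sum>n=1..x. real (rep_count S W n)) \<le> real x + real h / 1000" if "x \<le> 2 * N" for x
  proof -
    have "(\<Sum>n=1..x. real (rep_count S W n)) \<le> (\<Sum>n=1..x. 1 + (real (rep_count S W n) - 1)\<^sup>2)"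
    proof (intro sum_mono)
      fix n
      show "real (rep_count S W n) \<le> 1 + (real (rep_count S W n) - 1)\<^sup>2"
      proof (cases "rep_count S W n \<ge> 1")
        case True
        then have "0 \<le> (real (rep_count S W n) - 1) * (real (rep_count S W n) - 2) \<or> rep_count S W n = 1"
          by (cases "rep_count S W n = 1") auto
        then show ?thesis by (auto simp: power2_eq_square algebra_simps)
      next
        case False
        then have "rep_count S W n = 0" by simp
        then show ?thesis by simp
      qed
    qed
    also have "\<dots> = real x + (\<Sum>n=1..x. (real (rep_count S W n) - 1)\<^sup>2)"
      by (simp add: sum.distrib)
    also have "(\<Sum>n=1..x. (real (rep_count S W n) - 1)\<^sup>2) \<le> D"
      unfolding D_def using that by (intro sum_mono2) auto
    finally show ?thesis using D by linarith
  qed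
  have f_ge: "real x - real n0 \<le> (\<Sum>n=1..x. real (rep_count S W n))" for x
  proof -
    have "real x - real n0 \<le> real (card {n0<..x})" by simp
    also have "\<dots> = (\<Sum>n\<in>{n0<..x}. 1)" by simp
    also have "\<dots> \<le> (\<Sum>n\<in>{n0<..x}. real (rep_count S W n))"
      using n0 by (intro sum_mono) (simp add: Suc_leI)
    also have "\<dots> \<le> (\<Sum>n=1..x. real (rep_count S W n))"
      by (intro sum_mono2) auto
    finally show ?thesis .
  qed
  have S_bounds: "9/10 * c * real x powr q \<le> real (counting S (real x))"
      "real (counting S (real x)) \<le> 11/10 * c * real x powr q" if "h \<le> x" "x \<le> 2 * K" for x
  proof -
    have "1 / real r / (6400 * real R) \<le> 1/10"
      using q R64 unfolding q_def [symmetric] by (simp add: field_simps)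
    then have "1 / real r / (6400 * real R) * c * real h powr q \<le> 1/10 * c * real x powr q"
      using c q that by (intro mult_mono powr_mono2) auto
    with asym [OF that] show "9/10 * c * real x powr q \<le> real (counting S (real x))"
      "real (counting S (real x)) \<le> 11/10 * c * real x powr q"
      unfolding q_def [symmetric] by linarith+
  qed

  have "real J / (64 * c) \<le> (\<Sum>w\<in>{w\<in>W. 64 * h < w \<and> w \<le> 64 ^ (J+1) * h}. real w powr (q - 1))"
  proof (rule sum_powr_dyadic_ge [OF q c])
    show "1 \<le> h" using h by simp
    fix i assume i: "i \<in> {1..J}"
    define H where "H = 64 ^ i * h"
    have "1 * h \<le> 64 ^ i * h" by (intro mult_right_mono) auto
    then have H: "h \<le> H" unfolding H_def by simp
    have "64 ^ (i + 1) * h \<le> 64 ^ (J + 1) * h" using i by (intro mult_right_mono power_increasing) auto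
    then have H': "64 * H \<le> K" unfolding H_def K R by simp
    have "real H powr (1 - q) / c \<le> real (counting W (real (64 * H))) - real (counting W (real H))"
    proof (rule counting_dyadic_ge [OF q c S W])
      show "0 < H" using H h by simp
      show "9/10 * c * real H powr q \<le> real (counting S (real H))"
        using H H' by (intro S_bounds) auto
      show "real (counting S (real (64 * H))) \<le> 11/10 * c * real (64 * H) powr q"
        using H H' by (intro S_bounds) auto
      show "(\<Sum>n=1..2*H. real (rep_count S W n)) \<le> 21/10 * real H"
        using f_le [of "2 * H"] H H' NK by simp
      show "63 * real H \<le> (\<Sum>n=1..64*H. real (rep_count S W n))"
        using f_ge [of "64 * H"] H h by simp
    qed
    then show "real (64 ^ i * h) powr (1 - q) / c \<le> real (counting W (real (64 ^ (i+1) * h))) - real (counting W (real (64 ^ i * h)))"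
      unfolding H_def by (simp add: mult_ac)
  qed
  also have "\<dots> \<le> (\<Sum>w\<in>{w\<in>W. 3 * h < w \<and> w \<le> K}. real w powr (q - 1))"
    unfolding K R by (intro sum_mono2) auto
  finally have sumW: "real J / (64 * c) \<le> (\<Sum>w\<in>{w\<in>W. 3 * h < w \<and> w \<le> K}. real w powr (q - 1))" .

  define m where "m = (\<lambda>w::nat. c * q * real L / 4 * real w powr (q - 1))"
  let ?a1 = "\<lambda>x. indic S x * \<rho> ^ x" and ?b1 = "\<lambda>x. indic W x * \<rho> ^ x"
  let ?a2 = "indic {s\<in>S. s \<le> h}" and ?b2 = "indic {w\<in>W. w \<le> h}"
  have lower: "real (card {s\<in>S. s \<le> h}) * real (card {w\<in>W. w \<le> h}) * \<rho> ^ (2 * K + h) * (\<Sum>w\<in>{w\<in>W. 3*h < w \<and> w \<le> K}. m w)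
     \<le> (\<Sum>d=1..L. lag_corr N d ?a1 ?b2 ?a2 ?b1)"
  proof (rule sum_lag_corr_ge)
    fix w y assume "w \<in> W" "3 * h < w" "w \<le> K" "w \<le> y + h" "y \<le> w + h"
    then show "m w \<le> real (card (S \<inter> {y-L..<y}))"
      unfolding m_def using h L K
      by (intro card_window_ge [OF q c _ _ _ _ asym [unfolded K, folded q_def]]) auto
  qed (use rho hN c q in \<open>auto simp: m_def\<close>)
  have "real h / 2 \<le> real h - real n0" using h by simp
  also have "\<dots> \<le> real (\<Sum>n=1..h. rep_count S W n)" using f_ge [of h] by simp
  also have "\<dots> \<le> real (counting S (real h) * counting W (real h))"
    by (rule of_nat_mono [OF sum_rep_count_le [OF S W]])
  also have "counting S (real h) = card {s\<in>S. s \<le> h}"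
    unfolding counting_of_nat using S by (intro arg_cong [where f=card]) auto
  also have "counting W (real h) = card {w\<in>W. w \<le> h}"
    unfolding counting_of_nat using W by (intro arg_cong [where f=card]) auto
  finally have AB: "real h / 2 \<le> real (card {s\<in>S. s \<le> h}) * real (card {w\<in>W. w \<le> h})" by simp
  \<comment> \<open>The exponent \<open>- (2 * K + h) / K\<close> is at least -3, and
    \<open>exp 1 \<le> 3\<close>.\<close>
  have rho3: "1/27 \<le> \<rho> ^ (2 * K + h)"
  proof -
    have "(1/27::real) = (1/3) ^ 3" by (simp add: power3_eq_cube)
    also have "\<dots> \<le> exp (-1) ^ 3"
      using exp_le by (intro power_mono) (auto simp: exp_minus field_simps)
    also have "\<dots> = exp (-3)" by (simp add: exp_of_nat_mult [symmetric])
    also have "\<dots> \<le> exp (- real (2 * K + h) / real K)"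
      using K64 K0 by (simp add: field_simps)
    finally show ?thesis by (simp only: rho_pow)
  qed
  have "8 * real h * real L = real h / 2 * (1/27) * (c * q * real L / 4 * (real J / (64 * c)))"
    using c r unfolding J q_def by (simp add: field_simps)
  also have "\<dots> \<le> real (card {s\<in>S. s \<le> h}) * real (card {w\<in>W. w \<le> h}) * \<rho> ^ (2 * K + h) * (c * q * real L / 4 * (\<Sum>w\<in>{w\<in>W. 3*h < w \<and> w \<le> K}. real w powr (q - 1)))"
    using AB rho3 sumW c q by (intro mult_mono mult_left_mono) auto
  also have "\<dots> \<le> (\<Sum>d=1..L. lag_corr N d ?a1 ?b2 ?a2 ?b1)"
    using lower unfolding m_def sum_distrib_left [symmetric] .
  also have "\<dots> \<le> (\<Sum>d=1..L. 6 * real h)"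
  proof (intro sum_mono)
    fix d assume d: "d \<in> {1..L}"
    \<comment> \<open>\<open>\<rho> ^ (2 * N) = exp (- 2 * X)\<close> has to beat the factor
      \<open>X * R\<close> by which \<open>N\<close> exceeds \<open>h\<close>.\<close>
    have NR: "real (N + d) * \<rho> ^ (2 * N) \<le> real h / 800"
    proof -
      have "\<rho> ^ (2 * N) = exp (- 2 * real X)"
        unfolding rho_pow N using K0 by simp
      moreover have "real (N + d) \<le> 2 * real N" using d L hN by simp
      ultimately have "real (N + d) * \<rho> ^ (2 * N) \<le> 2 * real N * exp (- 2 * real X)"
        by (simp add: mult_right_mono)
      also have "\<dots> = real h / 8 * (16 * real X * real R * exp (- 2 * real X))"
        unfolding N K by simp
      also have "\<dots> \<le> real h / 8 * (1/100)" using X by (intro mult_left_mono) auto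
      finally show ?thesis by simp
    qed
    have "lag_form N d ?a1 ?b1 ?a1 ?b1 \<le> 4 * real d + 8 * (1 + D + real (N + d) * \<rho> ^ (2 * N))"
      unfolding D_def by (rule lag_form_weighted_le [OF S rho(1,2)])
    \<comment> \<open>The thousandths are 10 from the lag, 1 from the constant 8 as
      \<open>8000 \<le> h\<close>, 8 from \<open>D\<close> and 10 from the tail.\<close>
    also have "\<dots> \<le> 29/1000 * real h" using D NR d L h by simp
    finally have Y1: "lag_form N d ?a1 ?b1 ?a1 ?b1 \<le> 29/1000 * real h" .
    have "lag_form N d ?a2 ?b2 ?a2 ?b2 \<le> 16 * real h + 8 * D"
      unfolding D_def by (rule lag_form_initial_le [OF S hN(1)])
    also have "\<dots> \<le> 17 * real h" using D by simp
    finally have Y2: "lag_form N d ?a2 ?b2 ?a2 ?b2 \<le> 17 * real h" .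
    \<comment> \<open>The product \<open>29/1000 * 17\<close> is below 1, which permits
      \<open>y = h\<close>.\<close>
    have "lag_corr N d ?a1 ?b2 ?a2 ?b1 \<le> 2 * (\<Sum>z\<le>2*N. conv N ?a1 ?b2 z * conv N ?a2 ?b1 z) + real h"
      using rho by (intro lag_corr_le_sqrt [OF _ _ _ _ Y1 Y2]) (auto simp: power2_eq_square)
    also have "(\<Sum>z\<le>2*N. conv N ?a1 ?b2 z * conv N ?a2 ?b1 z) \<le> 2 * real h + 4 * D"
      unfolding D_def using rho
      by (intro sum_conv_mult_conv_le [OF S hN(1)]) (auto intro: power_le_one)
    finally show "lag_corr N d ?a1 ?b2 ?a2 ?b1 \<le> 6 * real h" using D by simp
  qed
  also have "\<dots> = 6 * real h * real L" by simp
  finally show False using h L by simp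
qed

section \<open>Choice of the parameters and passage to a fixed scale\<close>

lemma exp_minus_bound:
  fixes x R :: real
  assumes R: "1 \<le> R" and x: "x = 800 * R"
  shows "16 * x * R * exp (- 2 * x) \<le> 1/100"
proof -
  have "2 * x\<^sup>2 \<le> 1 + 2 * x + (2 * x)\<^sup>2 / 2" using R x by (simp add: power_mult_distrib)
  also have "\<dots> \<le> exp (2 * x)" using R x by (intro exp_lower_Taylor_quadratic) simp
  finally have e: "2 * x\<^sup>2 \<le> exp (2 * x)" .
  have "16 * x * R * exp (- 2 * x) = 16 * x * R / exp (2 * x)" by (simp add: exp_minus divide_inverse)
  also have "\<dots> \<le> 16 * x * R / (2 * x\<^sup>2)"
    using R x by (intro divide_left_mono [OF e]) simp_all
  also have "\<dots> = 1/100" using R unfolding x by (simp add: power2_eq_square)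
  finally show ?thesis .
qed

lemma counting_asymptotics:
  fixes c q \<tau> :: real
  assumes "(\<lambda>x. real (counting S x)) \<sim>[at_top] (\<lambda>x. c * x powr q)" "0 < c" "0 < \<tau>"
  shows "\<forall>\<^sub>F x in sequentially. \<bar>real (counting S (real x)) - c * real x powr q\<bar> \<le> \<tau> * c * real x powr q"
proof -
  \<comment> \<open>\<open>asymp_equiv_def\<close> sets the quotient to 1 where both functions
    vanish; for \<open>x > 0\<close> the comparison function is positive, which rules this case
    out.\<close>
  have "\<forall>\<^sub>F x in at_top. \<bar>real (counting S x) - c * x powr q\<bar> \<le> \<tau> * c * x powr q"
    using tendstoD [OF assms(1)[unfolded asymp_equiv_def] \<open>0 < \<tau>\<close>] eventually_gt_at_top [of "0::real"]
  proof eventually_elim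
    case (elim x)
    define g where "g = c * x powr q"
    have pos: "0 < g" using elim \<open>0 < c\<close> by (simp add: g_def)
    have "\<bar>real (counting S x) / g - 1\<bar> < \<tau>"
      using elim pos by (auto simp: dist_real_def g_def split: if_splits)
    then have "\<bar>real (counting S x) / g - 1\<bar> * g \<le> \<tau> * g"
      using pos by (intro mult_right_mono) auto
    also have "\<bar>real (counting S x) / g - 1\<bar> * g = \<bar>(real (counting S x) / g - 1) * g\<bar>"
      using pos by (simp add: abs_mult)
    also have "(real (counting S x) / g - 1) * g = real (counting S x) - g"
      using pos by (simp add: left_diff_distrib)
    finally show ?case by (simp add: g_def mult_ac)
  qed
  then show ?thesis by (rule eventually_compose_filterlim [OF _ filterlim_real_sequentially])
qed

text \<open>For \<open>f \<ge> 1\<close> the bound of \<open>f\<close> by the counting function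
  gives the claim termwise. Where \<open>f = 0\<close>, which happens only below \<open>n0\<close>,
  the term \<open>f - 1 = -1\<close> must be raised to 1, hence the factor 2.\<close>

lemma sum_square_excess_le:
  assumes S: "S \<subseteq> {1..}" and n0: "\<And>n. n0 \<le> n \<Longrightarrow> 1 \<le> rep_count S W n" and pos: "1 \<le> counting S (real M)"
  shows "(\<Sum>n=1..M. (real (rep_count S W n) - 1)\<^sup>2)
    \<le> real (counting S (real M)) * ((\<Sum>n=1..M. real (rep_count S W n)) - real M + 2 * real n0)"
proof -
  let ?f = "\<lambda>n. real (rep_count S W n)" and ?s = "real (counting S (real M))"
  have "(\<Sum>n=1..M. (?f n - 1)\<^sup>2) \<le> (\<Sum>n=1..M. ?s * (?f n - 1 + 2 * of_bool (n < n0)))"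
  proof (intro sum_mono)
    fix n assume "n \<in> {1..M}"
    then have le: "?f n \<le> ?s" using rep_count_le_counting [OF S, of n M W] by simp
    show "(?f n - 1)\<^sup>2 \<le> ?s * (?f n - 1 + 2 * of_bool (n < n0))"
    proof (cases "1 \<le> rep_count S W n")
      case True
      then have "(?f n - 1) * (?f n - 1) \<le> ?s * (?f n - 1 + 2 * of_bool (n < n0))"
        using le by (intro mult_mono) auto
      then show ?thesis by (simp add: power2_eq_square)
    next
      case False
      then have "n < n0" "rep_count S W n = 0" using n0 [of n] by (meson leI, linarith)
      then show ?thesis using pos by simp
    qed
  qed
  also have "\<dots> = ?s * ((\<Sum>n=1..M. ?f n) - real M + 2 * (\<Sum>n=1..M. of_bool (n < n0)))"
    by (simp add: sum_distrib_left [symmetric] sum.distrib sum_subtractf)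
  also have "(\<Sum>n=1..M. of_bool (n < n0)) = real (card ({1..M} \<inter> {n. n < n0}))"
    by (simp add: of_bool_def sum.If_cases)
  also have "card ({1..M} \<inter> {n. n < n0}) \<le> card {..<n0}"
    by (intro card_mono) auto
  finally show ?thesis by (simp add: mult_left_mono)
qed

theorem theorem1:
  fixes r :: nat and c :: real
  assumes "r \<ge> 2" and "c > 0"
  shows "\<exists>C>0. \<forall>S W :: nat set.
           S \<subseteq> {1..} \<longrightarrow>
           (\<lambda>x. real (counting S x)) \<sim>[at_top] (\<lambda>x. c * x powr (1 / real r)) \<longrightarrow>
           additive_complement W S \<longrightarrow>
           (\<forall>\<^sub>F N in sequentially.
              (\<Sum>n=1..N. real (rep_count S W n)) - real N \<ge> C * real N powr (1 - 1 / real r))"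
proof -
  define J where "J = 110592 * r"
  define R :: nat where "R = 64 ^ (J + 1)"
  define X where "X = 800 * R"
  define q where "q = 1 / real r"
  \<comment> \<open>With this excess and \<open>counting S M \<le> 2 * c * M powr q\<close>, the
    main part of the sum of squares is \<open>2 * c * C * M = M / (8000 * X * R)\<close>, half of
    what is permitted. Only \<open>r\<close> and \<open>c\<close> enter.\<close>
  define C where "C = 1 / (16000 * c * real X * real R)"
  \<comment> \<open>The last factor \<open>2 * R\<close> turns a relative error at any
    \<open>x \<le> 2 * R * h\<close> into one relative to \<open>h powr q\<close>.\<close>
  define \<tau> where "\<tau> = q / (6400 * real R) / (2 * real R)"
  have q: "0 < q" "q \<le> 1/2" using assms(1) by (auto simp: q_def field_simps)
  have R: "1 \<le> R" unfolding R_def by simp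
  have X: "2 \<le> X" using R unfolding X_def by simp
  have X': "16 * real X * real R * exp (- 2 * real X) \<le> 1/100"
    using R by (intro exp_minus_bound) (simp_all add: X_def)
  have "0 < \<tau>" unfolding \<tau>_def using q R by simp
  have "\<tau> \<le> 1/2"
  proof -
    have "q / (6400 * real R) \<le> q / 1" using q R by (intro divide_left_mono) auto
    moreover have "\<tau> \<le> q / (6400 * real R) / 1" unfolding \<tau>_def using q R by (intro divide_left_mono) auto
    ultimately show ?thesis using q by simp
  qed
  note \<tau> = \<open>0 < \<tau>\<close> \<open>\<tau> \<le> 1/2\<close>
  have "C > 0" unfolding C_def using assms X R by simp
  moreover have "\<forall>\<^sub>F M in sequentially. (\<Sum>n=1..M. real (rep_count S W n)) - real M \<ge> C * real M powr (1 - q)"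
    if S: "S \<subseteq> {1..}" and as: "(\<lambda>x. real (counting S x)) \<sim>[at_top] (\<lambda>x. c * x powr q)"
      and ac: "additive_complement W S" for S W
  proof -
    have W: "W \<subseteq> {1..}" using ac by (simp add: additive_complement_def)
    obtain n0 where n0: "\<And>n. n0 \<le> n \<Longrightarrow> 1 \<le> rep_count S W n"
    proof -
      from ac obtain n0 where "\<And>n. n0 \<le> n \<Longrightarrow> \<exists>w\<in>W. \<exists>s\<in>S. n = w + s"
        by (auto simp: additive_complement_def eventually_sequentially)
      then have "{(s, w) \<in> S \<times> W. n = s + w} \<noteq> {}" if "n0 \<le> n" for n
      proof -
        from \<open>\<And>n. n0 \<le> n \<Longrightarrow> \<exists>w\<in>W. \<exists>s\<in>S. n = w + s\<close> [OF that]
        obtain w s where "w \<in> W" "s \<in> S" "n = w + s" by blast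
        then have "(s, w) \<in> {(s, w) \<in> S \<times> W. n = s + w}" by simp
        then show ?thesis by blast
      qed
      then have "1 \<le> rep_count S W n" if "n0 \<le> n" for n
        using that unfolding rep_count_def Suc_le_eq One_nat_def card_gt_0_iff by (intro conjI finite_reps)
      then show ?thesis by (rule that)
    qed
    obtain x0 where x0: "\<And>x. x0 \<le> x \<Longrightarrow> \<bar>real (counting S (real x)) - c * real x powr q\<bar> \<le> \<tau> * c * real x powr q"
      using counting_asymptotics [OF as assms(2) \<tau>(1)] by (auto simp: eventually_sequentially)
    \<comment> \<open>The integers below \<open>n0\<close> contribute a multiple of
      \<open>M powr q \<le> sqrt M\<close>; once \<open>M \<ge> \<kappa>\<^sup>2\<close>, this fits
      into the other half of the permitted sum.\<close>
    define \<kappa> where "\<kappa> = 32000 * c * real n0 * real X * real R"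
    have key: "C * real M powr (1 - q) \<le> (\<Sum>n=1..M. real (rep_count S W n)) - real M"
      if M: "2 * X * R * (8000 + 100 * n0 + x0) \<le> M" "\<kappa>\<^sup>2 \<le> real M" for M
    proof (rule ccontr)
      assume contra: "\<not> ?thesis"
      define P where "P = 2 * X * R"
      \<comment> \<open>The largest \<open>h\<close> for which \<open>N = X * R * h\<close>
        satisfies \<open>2 * N \<le> M\<close>; rounding down costs at most a factor 2.\<close>
      define h where "h = M div P"
      have P: "0 < P" using X R by (simp add: P_def)
      have "8000 + 100 * n0 + x0 \<le> h"
        unfolding h_def less_eq_div_iff_mult_less_eq [OF P] using M(1) by (simp only: P_def mult.commute)
      then have h: "8000 \<le> h" "100 * n0 \<le> h" "x0 \<le> h" by linarith+
      have Ph: "P * h \<le> M" unfolding h_def by (rule times_div_less_eq_dividend)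
      then have hM: "2 * (X * (R * h)) \<le> M" by (simp only: P_def mult.assoc)
      have "M < P + P * h" unfolding h_def by (rule dividend_less_times_div [OF P])
      moreover have "P * 1 \<le> P * h" using h by (intro mult_left_mono) linarith+
      ultimately have "M \<le> 2 * (P * h)" by linarith
      then have "real M \<le> real (2 * (P * h))" by (rule of_nat_mono)
      then have Mh: "real M \<le> 4 * real X * real R * real h" by (simp add: P_def)
      have "1 * h \<le> P * h" using P by (intro mult_right_mono) linarith+
      with Ph h have M0: "x0 \<le> M" "0 < M" by linarith+
      have sM: "real (counting S (real M)) \<le> 2 * c * real M powr q" and "1 \<le> counting S (real M)"
      proof -
        have pos: "0 < c * real M powr q" using assms M0 by simp
        then have "\<tau> * (c * real M powr q) \<le> 1/2 * (c * real M powr q)"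
          using \<tau> by (intro mult_right_mono) auto
        with x0 [OF M0(1)] pos have "real (counting S (real M)) \<le> 2 * (c * real M powr q)" "0 < real (counting S (real M))"
          unfolding abs_le_iff mult.assoc by linarith+
        then show "real (counting S (real M)) \<le> 2 * c * real M powr q" "1 \<le> counting S (real M)" by auto
      qed
      have "(\<Sum>n=1..M. (real (rep_count S W n) - 1)\<^sup>2) \<le>
          real (counting S (real M)) * ((\<Sum>n=1..M. real (rep_count S W n)) - real M + 2 * real n0)"
        by (rule sum_square_excess_le [OF S n0 \<open>1 \<le> counting S (real M)\<close>])
      also have "\<dots> \<le> real (counting S (real M)) * (C * real M powr (1 - q) + 2 * real n0)"
        using contra by (intro mult_left_mono) auto
      also have "\<dots> \<le> 2 * c * real M powr q * (C * real M powr (1 - q) + 2 * real n0)"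
        using sM \<open>C > 0\<close> by (intro mult_right_mono) auto
      also have "\<dots> = 2 * c * C * real M + 4 * c * real n0 * real M powr q"
        using M0 by (simp add: powr_diff algebra_simps)
      also have "\<dots> \<le> 2 * c * C * real M + 4 * c * real n0 * sqrt (real M)"
      proof -
        have "real M powr q \<le> real M powr (1/2)" using M0 q by (intro powr_mono) auto
        then show ?thesis using assms by (auto simp: powr_half_sqrt intro!: mult_left_mono)
      qed
      also have "\<dots> \<le> real M / (4000 * real X * real R)"
      proof -
        have "\<kappa> \<le> sqrt (real M)" using M(2) by (rule real_le_rsqrt)
        then have "\<kappa> * sqrt (real M) \<le> sqrt (real M) * sqrt (real M)" by (intro mult_right_mono) auto
        then have "32000 * c * real n0 * real X * real R * sqrt (real M) \<le> real M" unfolding \<kappa>_def by simp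
        then have "4 * c * real n0 * sqrt (real M) \<le> real M / (8000 * real X * real R)"
          using X R by (simp add: field_simps)
        moreover have "2 * c * C * real M = real M / (8000 * real X * real R)"
          unfolding C_def using assms by simp
        moreover have "real M / (8000 * real X * real R) + real M / (8000 * real X * real R) = real M / (4000 * real X * real R)"
          using X R by (simp add: field_simps)
        ultimately show ?thesis by linarith
      qed
      also have "\<dots> \<le> real h / 1000"
        using Mh X R by (simp add: field_simps)
      finally have "(\<Sum>n=1..M. (real (rep_count S W n) - 1)\<^sup>2) \<le> real h / 1000" .
      moreover have "(\<Sum>n=1..2*(X*(R*h)). (real (rep_count S W n) - 1)\<^sup>2) \<le> (\<Sum>n=1..M. (real (rep_count S W n) - 1)\<^sup>2)"
        using hM by (intro sum_mono2) auto
      ultimately have \<Delta>: "(\<Sum>n=1..2*(X*(R*h)). (real (rep_count S W n) - 1)\<^sup>2) \<le> real h / 1000" by linarith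
      show False
      proof (rule no_almost_tiling [OF assms S W J_def R_def refl refl X X' h(1,2) n0 _ \<Delta>])
        fix x assume x: "h \<le> x" "x \<le> 2 * (R * h)"
        have "real x powr q \<le> real (2 * R * h) powr q"
          using x q by (intro powr_mono2) (auto simp flip: of_nat_mult simp: mult_ac)
        also have "\<dots> = (2 * real R) powr q * real h powr q"
          by (simp add: powr_mult)
        also have "\<dots> \<le> (2 * real R) powr 1 * real h powr q"
          using R q by (intro mult_right_mono powr_mono) auto
        finally have "\<tau> * c * real x powr q \<le> \<tau> * c * (2 * real R * real h powr q)"
          using \<tau> assms by (intro mult_left_mono) auto
        also have "\<dots> = q / (6400 * real R) * c * real h powr q"
          unfolding \<tau>_def using R by simp
        finally show "\<bar>real (counting S (real x)) - c * real x powr (1 / real r)\<bar> \<le> 1 / real r / (6400 * real R) * c * real h powr (1 / real r)"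
          using x0 [of x] x h unfolding q_def by linarith
      qed
    qed
    have large: "\<forall>\<^sub>F M in sequentially. 2 * X * R * (8000 + 100 * n0 + x0) \<le> M"
      by (rule eventually_ge_at_top)
    have "\<forall>\<^sub>F M in sequentially. \<kappa>\<^sup>2 \<le> real M"
      by (rule eventually_compose_filterlim [OF eventually_ge_at_top filterlim_real_sequentially])
    with large show ?thesis by eventually_elim (rule key)
  qed
  ultimately show ?thesis
    by (intro exI [of _ C] conjI allI impI) (simp_all only: q_def)
qed

end
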